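(* Let $n\ge2$. There exist unitaries $u\in\mathcal S_n$ such that $\lambda_u\notin\operatorname{Aut}(\mathcal O_n)\lambda(\mathcal F_n)$, i.e. such that $\lambda_u\neq\psi\circ\lambda_w$ for all $\psi\in\operatorname{Aut}(\mathcal O_n)$ and all unitaries $w\in\mathcal F_n$.
   Context: $\mathcal O_n$ is the Cuntz algebra, the $C^*$-algebra generated by isometries $S_1,\dots,S_n$ with $\sum_{i=1}^n S_iS_i^*=1$. For a word $\mu=(\mu_1,\dots,\mu_k)$ in the letters $1,\dots,n$ put $S_\mu=S_{\mu_1}\cdots S_{\mu_k}$ ($=1$ for the empty word). $\mathcal F_n$ is the core UHF-subalgebra: the closed linear span of all $S_\mu S_\nu^*$ with $\mu,\nu$ words of equal length. $\mathcal S_n$ is the group of unitaries in $\mathcal O_n$ that are finite sums of elements of the form $S_\alpha S_\beta^*$ ($\alpha,\beta$ words). For a unitary $u\in\mathcal O_n$, $\lambda_u$ is the unital $*$-endomorphism of $\mathcal O_n$ with $\lambda_u(S_i)=uS_i$. $\lambda(\mathcal F_n)=\{\lambda_w: w\text{ a unitary in }\mathcal F_n\}$. *)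

theory Defs
  imports "HOL-Analysis.Analysis"
begin

section \<open>Unital C*-algebras\<close>

text \<open>Unital C*-algebras with \<^prop>\<open>0 \<noteq> 1\<close>, the carrier being the whole type. The real scalar
  multiplication of the library classes is the restriction of the complex one.\<close>

class unital_cstar_algebra = real_normed_algebra_1 + banach +
  fixes scaleC :: "complex \<Rightarrow> 'a \<Rightarrow> 'a"  (infixr \<open>*\<^sub>C\<close> 75)
    and star :: "'a \<Rightarrow> 'a"  (\<open>_\<^sup>\<star>\<close> [1000] 999)
  assumes scaleR_eq_scaleC: "scaleR r x = complex_of_real r *\<^sub>C x"
    and scaleC_add_right: "a *\<^sub>C (x + y) = a *\<^sub>C x + a *\<^sub>C y"
    and scaleC_add_left: "(a + b) *\<^sub>C x = a *\<^sub>C x + b *\<^sub>C x"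
    and scaleC_scaleC: "a *\<^sub>C (b *\<^sub>C x) = (a * b) *\<^sub>C x"
    and mult_scaleC_left: "(a *\<^sub>C x) * y = a *\<^sub>C (x * y)"
    and mult_scaleC_right: "x * (a *\<^sub>C y) = a *\<^sub>C (x * y)"
    and norm_scaleC: "norm (a *\<^sub>C x) = cmod a * norm x"
    and star_star: "(x\<^sup>\<star>)\<^sup>\<star> = x"
    and star_add: "(x + y)\<^sup>\<star> = x\<^sup>\<star> + y\<^sup>\<star>"
    and star_scaleC: "(a *\<^sub>C x)\<^sup>\<star> = cnj a *\<^sub>C x\<^sup>\<star>"
    and star_mult: "(x * y)\<^sup>\<star> = y\<^sup>\<star> * x\<^sup>\<star>"
    and cstar_identity: "norm (x\<^sup>\<star> * x) = (norm x)\<^sup>2"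

global_interpretation complex_vector:
  vector_space "scaleC :: complex \<Rightarrow> 'a \<Rightarrow> 'a::unital_cstar_algebra"
proof
  show "1 *\<^sub>C x = x" for x :: 'a
    using scaleR_eq_scaleC[of 1 x] by simp
qed (fact scaleC_add_right scaleC_add_left scaleC_scaleC)+

definition cstar_isometry :: "'a::unital_cstar_algebra \<Rightarrow> bool" where
  "cstar_isometry v \<longleftrightarrow> v\<^sup>\<star> * v = 1"

definition cstar_unitary :: "'a::unital_cstar_algebra \<Rightarrow> bool" where
  "cstar_unitary u \<longleftrightarrow> u\<^sup>\<star> * u = 1 \<and> u * u\<^sup>\<star> = 1"

definition cstar_subalgebra :: "'a::unital_cstar_algebra set \<Rightarrow> bool" where
  "cstar_subalgebra B \<longleftrightarrow>
     closed B \<and> complex_vector.subspace B \<and>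
     (\<forall>x\<in>B. \<forall>y\<in>B. x * y \<in> B) \<and> (\<forall>x\<in>B. x\<^sup>\<star> \<in> B)"

text \<open>No continuity is required: *-homomorphisms of C*-algebras are automatically contractive.\<close>

definition unital_star_hom ::
    "('a::unital_cstar_algebra \<Rightarrow> 'b::unital_cstar_algebra) \<Rightarrow> bool" where
  "unital_star_hom f \<longleftrightarrow>
     (\<forall>x y. f (x + y) = f x + f y) \<and> (\<forall>a x. f (a *\<^sub>C x) = a *\<^sub>C f x) \<and>
     (\<forall>x y. f (x * y) = f x * f y) \<and> (\<forall>x. f (x\<^sup>\<star>) = (f x)\<^sup>\<star>) \<and> f 1 = 1"

definition star_automorphisms :: "('a::unital_cstar_algebra \<Rightarrow> 'a) set" where
  "star_automorphisms = {\<psi>. unital_star_hom \<psi> \<and> bij \<psi>}"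


section \<open>Cuntz algebras\<close>

text \<open>\<open>cuntz_algebra n S\<close> says that the whole algebra \<^typ>\<open>'a\<close>, with the generators
  \<open>S 1, \<dots>, S n\<close>, is \<open>\<O>\<^sub>n\<close>. For \<open>n \<ge> 2\<close> these relations determine the algebra up to a
  unique generator-preserving isomorphism. The values of \<open>S\<close> outside \<open>{1..n}\<close> are irrelevant.\<close>

definition cuntz_algebra :: "nat \<Rightarrow> (nat \<Rightarrow> 'a::unital_cstar_algebra) \<Rightarrow> bool" where
  "cuntz_algebra n S \<longleftrightarrow>
     (\<forall>i\<in>{1..n}. cstar_isometry (S i)) \<and> (\<Sum>i=1..n. S i * (S i)\<^sup>\<star>) = 1 \<and>
     cstar_subalgebra hull (S ` {1..n}) = UNIV"

definition words :: "nat \<Rightarrow> nat list set" where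
  "words n = lists {1..n}"

definition word_isometry :: "(nat \<Rightarrow> 'a::unital_cstar_algebra) \<Rightarrow> nat list \<Rightarrow> 'a" where
  "word_isometry S \<mu> = prod_list (map S \<mu>)"

definition core_UHF :: "nat \<Rightarrow> (nat \<Rightarrow> 'a::unital_cstar_algebra) \<Rightarrow> 'a set" where
  "core_UHF n S = closure (complex_vector.span
     {word_isometry S \<mu> * (word_isometry S \<nu>)\<^sup>\<star> | \<mu> \<nu>.
        \<mu> \<in> words n \<and> \<nu> \<in> words n \<and> length \<mu> = length \<nu>})"

definition word_sum_unitaries :: "nat \<Rightarrow> (nat \<Rightarrow> 'a::unital_cstar_algebra) \<Rightarrow> 'a set" where
  "word_sum_unitaries n S = {u. cstar_unitary u \<and>
     (\<exists>ps. set ps \<subseteq> words n \<times> words n \<and>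
        u = (\<Sum>(\<alpha>, \<beta>)\<leftarrow>ps. word_isometry S \<alpha> * (word_isometry S \<beta>)\<^sup>\<star>))}"

text \<open>\<open>is_lambda n S u \<rho>\<close> says that \<open>\<rho>\<close> is \<open>\<lambda>\<^sub>u\<close>. It is a relation because existence and
  uniqueness of \<open>\<lambda>\<^sub>u\<close> for each unitary \<open>u\<close> of a Cuntz algebra are theorems, not proved here.\<close>

definition is_lambda ::
    "nat \<Rightarrow> (nat \<Rightarrow> 'a::unital_cstar_algebra) \<Rightarrow> 'a \<Rightarrow> ('a \<Rightarrow> 'a) \<Rightarrow> bool" where
  "is_lambda n S u \<rho> \<longleftrightarrow> unital_star_hom \<rho> \<and> (\<forall>i\<in>{1..n}. \<rho> (S i) = u * S i)"

definition lambda_core :: "nat \<Rightarrow> (nat \<Rightarrow> 'a::unital_cstar_algebra) \<Rightarrow> ('a \<Rightarrow> 'a) set" where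
  "lambda_core n S = {\<sigma>. \<exists>w. cstar_unitary w \<and> w \<in> core_UHF n S \<and> is_lambda n S w \<sigma>}"

end

theory Submission
  imports Defs
begin

text \<open>Let \<open>\<sigma>\<close> be the endomorphism with \<open>\<sigma>(S\<^sub>i) = S\<^sub>1S\<^sub>i\<close> for \<open>i < n\<close> and
  \<open>\<sigma>(S\<^sub>n) = S\<^sub>1S\<^sub>nS\<^sub>1\<^sup>\<star> + \<Sum>\<^sub>i\<^sub>\<ge>\<^sub>2 S\<^sub>iS\<^sub>i\<^sup>\<star>\<close>, and let \<open>\<rho>\<close> be the direct sum, along \<open>S\<^sub>1, \<dots>, S\<^sub>n\<close>, of \<open>n - 1\<close>
  copies of the identity and one copy of \<open>\<sigma>\<close>; then \<open>\<rho> = \<lambda>\<^sub>u\<close> with \<open>u \<in> \<S>\<^sub>n\<close>. If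
  \<open>\<rho> = \<psi> \<circ> \<lambda>\<^sub>w\<close> with \<open>w \<in> \<F>\<^sub>n\<close>, then the gauge automorphisms \<open>\<gamma>\<^sub>z\<close> fix \<open>w\<close>, so
  \<open>g\<^sub>z = \<psi>\<gamma>\<^sub>z\<psi>\<inverse>\<close> satisfies \<open>g\<^sub>z \<circ> \<rho> = \<rho> \<circ> \<gamma>\<^sub>z\<close>. As \<open>\<sigma>\<close> maps \<open>S\<^sub>1\<close> to \<open>S\<^sub>1\<^sup>2\<close>, which has
  another degree, \<open>\<gamma>\<^sub>z\<sigma>\<gamma>\<^sub>z\<inverse>\<close> is for \<open>z \<noteq> 1\<close> disjoint from both \<open>\<sigma>\<close> and the identity. This forces
  \<open>g\<^sub>z\<close> to map the projection \<open>p = 1 - S\<^sub>nS\<^sub>n\<^sup>\<star>\<close> below \<open>1 - p\<close>, and onto \<open>1 - p\<close> because \<open>\<sigma>\<close> is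
  irreducible. For \<open>z = \<i>\<close> and \<open>z = -1\<close> this contradicts \<open>g\<^sub>-\<^sub>1 = g\<^sub>\<i> \<circ> g\<^sub>\<i>\<close>.

  The existence of \<open>\<sigma>\<close> and \<open>\<gamma>\<^sub>z\<close> is Cuntz' uniqueness theorem. It is obtained by spectral-radius
  style estimates: the map from polynomials in one Cuntz family to polynomials in another one is
  bounded on elements of degree \<open>d\<close> by \<open>2d + 1\<close>, hence is contractive.\<close>

section \<open>Elementary facts on C*-algebras\<close>

context unital_cstar_algebra
begin

lemma star_one [simp]: "1\<^sup>\<star> = 1"
  by (metis mult_1_left mult_1_right star_mult star_star)

lemma star_zero [simp]: "0\<^sup>\<star> = 0"
  by (metis add_cancel_right_right star_add)

lemma star_eq_0_iff [simp]: "x\<^sup>\<star> = 0 \<longleftrightarrow> x = 0"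
  by (metis star_zero star_star)

lemma star_minus: "(- x)\<^sup>\<star> = - x\<^sup>\<star>"
  by (metis add.right_inverse add_eq_0_iff star_add star_zero)

lemma star_diff: "(x - y)\<^sup>\<star> = x\<^sup>\<star> - y\<^sup>\<star>"
  by (metis add_uminus_conv_diff star_add star_minus)

lemma star_sum: "(sum f A)\<^sup>\<star> = (\<Sum>a\<in>A. (f a)\<^sup>\<star>)"
  by (induction A rule: infinite_finite_induct) (auto simp: star_add)

lemma star_power: "(x ^ k)\<^sup>\<star> = x\<^sup>\<star> ^ k"
  by (induction k) (auto simp: star_mult power_commutes)

end

text \<open>The C*-identity bounds the square of \<open>norm y\<close> by
  \<open>norm (y\<^sup>\<star>) * norm y\<close>. Cancel one factor, then exchange \<open>y\<close>
  and \<open>y\<^sup>\<star>\<close>.\<close>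

lemma norm_star [simp]: "norm (x\<^sup>\<star>) = norm (x::'a::unital_cstar_algebra)"
proof -
  have le: "norm y \<le> norm (y\<^sup>\<star>)" for y :: 'a
  proof (cases "norm y = 0")
    case False
    have "norm y * norm y \<le> norm (y\<^sup>\<star>) * norm y"
      using norm_mult_ineq[of "y\<^sup>\<star>" y] unfolding cstar_identity by (simp only: power2_eq_square)
    with False show ?thesis
      by (metis mult_right_le_imp_le norm_ge_zero order_le_less)
  qed simp
  from le[of x] le[of "x\<^sup>\<star>"] show ?thesis
    by (simp add: star_star)
qed

lemma star_mult_self_eq_0_iff: "x\<^sup>\<star> * x = 0 \<longleftrightarrow> x = (0::'a::unital_cstar_algebra)"
  by (metis cstar_identity mult_zero_right norm_eq_zero power_zero_numeral zero_eq_power2)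

lemma tendsto_star [tendsto_intros]:
  fixes f :: "'b \<Rightarrow> 'a::unital_cstar_algebra"
  assumes "(f \<longlongrightarrow> l) F"
  shows "((\<lambda>x. (f x)\<^sup>\<star>) \<longlongrightarrow> l\<^sup>\<star>) F"
  using assms unfolding tendsto_iff dist_norm star_diff[symmetric] norm_star .

lemma tendsto_scaleC [tendsto_intros]:
  fixes f :: "'b \<Rightarrow> 'a::unital_cstar_algebra"
  assumes "(f \<longlongrightarrow> l) F"
  shows "((\<lambda>x. c *\<^sub>C f x) \<longlongrightarrow> c *\<^sub>C l) F"
proof -
  have "((\<lambda>x. (c *\<^sub>C 1) * f x) \<longlongrightarrow> (c *\<^sub>C 1) * l) F"
    by (intro tendsto_intros assms)
  thus ?thesis
    by (simp add: mult_scaleC_left)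
qed

lemma norm_scaleC_one [simp]: "norm (c *\<^sub>C (1::'a::unital_cstar_algebra)) = cmod c"
  by (simp add: norm_scaleC)

lemma norm_isometry:
  fixes v :: "'a::unital_cstar_algebra"
  assumes "v\<^sup>\<star> * v = 1"
  shows "norm v = 1"
proof -
  have "(norm v)\<^sup>2 = 1"
    using cstar_identity[of v] assms by simp
  thus ?thesis
    by (simp add: power2_eq_1_iff) (use norm_ge_zero[of v] in linarith)
qed

lemma norm_projection_le_1:
  fixes p :: "'a::unital_cstar_algebra"
  assumes "p\<^sup>\<star> = p" "p * p = p"
  shows "norm p \<le> 1"
proof -
  have "norm p = norm p * norm p"
    using cstar_identity[of p] assms by (simp add: power2_eq_square)
  thus ?thesis
    by (metis mult_cancel_right1 order_refl zero_le_one)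
qed

lemma norm_compression_le:
  fixes v w :: "'a::unital_cstar_algebra"
  assumes "norm v \<le> 1" "norm w \<le> 1"
  shows "norm (v\<^sup>\<star> * x * w) \<le> norm x"
proof -
  have "norm (v\<^sup>\<star> * x * w) \<le> norm (v\<^sup>\<star> * x) * norm w"
    by (rule norm_mult_ineq)
  also have "\<dots> \<le> norm (v\<^sup>\<star> * x) * 1"
    by (intro mult_left_mono assms) auto
  also have "norm (v\<^sup>\<star> * x) \<le> norm v * norm x"
    using norm_mult_ineq[of "v\<^sup>\<star>" x] by simp
  also have "\<dots> \<le> 1 * norm x"
    by (intro mult_right_mono assms) auto
  finally show ?thesis by simp
qed

lemma norm_power_selfadjoint:
  fixes b :: "'a::unital_cstar_algebra"
  assumes "b\<^sup>\<star> = b"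
  shows "norm (b ^ 2 ^ j) = norm b ^ 2 ^ j"
proof (induction j)
  case (Suc j)
  have "norm (b ^ 2 ^ Suc j) = norm ((b ^ 2 ^ j)\<^sup>\<star> * b ^ 2 ^ j)"
    by (simp add: star_power assms mult_2 power_add)
  also have "\<dots> = (norm (b ^ 2 ^ j))\<^sup>2"
    by (rule cstar_identity)
  finally show ?case
    by (simp add: Suc power2_eq_square mult_2 power_add)
qed simp

lemma le_if_power_le_linear:
  fixes \<alpha> \<beta> C :: real
  assumes "0 \<le> \<alpha>" and le: "\<And>j. \<beta> ^ 2 ^ j \<le> C * 2 ^ j * \<alpha> ^ 2 ^ j"
  shows "\<beta> \<le> \<alpha>"
proof (rule ccontr)
  assume "\<not> \<beta> \<le> \<alpha>"
  hence "\<alpha> < \<beta>" and "0 < \<beta>"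
    using assms by auto
  define x where "x = \<alpha> / \<beta>"
  have x: "0 \<le> x" "x < 1"
    using \<open>\<alpha> < \<beta>\<close> \<open>0 < \<beta>\<close> \<open>0 \<le> \<alpha>\<close> by (auto simp: x_def)
  have "(\<lambda>m. of_nat m * x ^ m) \<longlonglongrightarrow> 0"
    by (rule powser_times_n_limit_0) (use x in auto)
  hence "(\<lambda>j. C * (of_nat (2 ^ j) * x ^ 2 ^ j)) \<longlonglongrightarrow> C * 0"
    by (intro tendsto_mult_left LIMSEQ_subseq_LIMSEQ[where f = "\<lambda>j. 2 ^ j", unfolded o_def])
      (auto simp: strict_mono_def)
  moreover have "1 \<le> C * (of_nat (2 ^ j) * x ^ 2 ^ j)" for j
    using le[of j] \<open>0 < \<beta>\<close> by (simp add: x_def power_divide field_simps)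
  ultimately have "1 \<le> C * 0"
    by (intro LIMSEQ_le_const) auto
  thus False by simp
qed

subsection \<open>The unit is an extreme point of the unit ball\<close>

text \<open>Up to the factor 2^N this is the mean absolute deviation of a fair binomial variable,
  which is at most its standard deviation. The variance comes from the Bernstein moments at 1/2, and
  \<bar>t\<bar> \<le> (t^2 / r + r) / 2 with r = sqrt N takes the place of Cauchy-Schwarz.\<close>

lemma binomial_diff_sum_le:
  assumes "0 < N"
  shows "(\<Sum>k\<le>N. \<bar>2 * real k - real N\<bar> * real (N choose k)) \<le> 2 ^ N * sqrt N"
proof -
  define B where "B k = Bernstein N k (1/2)" for k
  have B: "B k = (N choose k) / 2 ^ N" if "k \<le> N" for k
    using that by (simp add: B_def Bernstein_def power_add[symmetric] power_one_over field_simps)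
  have Bnn: "0 \<le> B k" for k
    by (simp add: B_def Bernstein_def)
  have b0: "(\<Sum>k\<le>N. B k) = 1" and b1: "(\<Sum>k\<le>N. real k * B k) = N / 2"
    and b2: "(\<Sum>k\<le>N. real k * (real k - 1) * B k) = N * (real N - 1) / 4"
    using sum_Bernstein[of N "1/2"] sum_k_Bernstein[of N "1/2"] sum_kk_Bernstein[of N "1/2"]
    by (auto simp: B_def power2_eq_square)
  have var: "(\<Sum>k\<le>N. (2 * real k - N)\<^sup>2 * B k) = N"
  proof -
    have "(\<Sum>k\<le>N. (2 * real k - N)\<^sup>2 * B k)
      = (\<Sum>k\<le>N. 4 * (real k * (real k - 1) * B k) + (4 - 4 * real N) * (real k * B k) + (real N)\<^sup>2 * B k)"
      by (intro sum.cong refl) (simp add: power2_eq_square algebra_simps)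
    also have "\<dots> = 4 * (N * (real N - 1) / 4) + (4 - 4 * real N) * (N / 2) + (real N)\<^sup>2"
      by (simp only: sum.distrib sum_distrib_left[symmetric] b0 b1 b2 mult_1_right)
    also have "\<dots> = N"
      by (simp add: power2_eq_square field_simps)
    finally show ?thesis .
  qed
  define r where "r = sqrt N"
  have r: "0 < r" "r\<^sup>2 = N"
    using assms by (auto simp: r_def)
  have "(\<Sum>k\<le>N. \<bar>2 * real k - N\<bar> * B k) \<le> (\<Sum>k\<le>N. ((2 * real k - N)\<^sup>2 / r + r) / 2 * B k)"
  proof (intro sum_mono mult_right_mono Bnn)
    fix k
    have "0 \<le> (\<bar>2 * real k - N\<bar> - r)\<^sup>2" by simp
    thus "\<bar>2 * real k - N\<bar> \<le> ((2 * real k - N)\<^sup>2 / r + r) / 2"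
      using r(1) by (simp add: field_simps power2_eq_square)
  qed
  also have "\<dots> = (\<Sum>k\<le>N. 1 / (2 * r) * ((2 * real k - N)\<^sup>2 * B k) + r / 2 * B k)"
    by (intro sum.cong refl) (simp add: field_simps)
  also have "\<dots> = 1 / (2 * r) * N + r / 2"
    by (simp only: sum.distrib sum_distrib_left[symmetric] var b0 mult_1_right)
  also have "\<dots> = r"
    using r by (simp add: field_simps power2_eq_square)
  finally have "(\<Sum>k\<le>N. \<bar>2 * real k - N\<bar> * B k) \<le> r" .
  moreover have "(\<Sum>k\<le>N. \<bar>2 * real k - N\<bar> * real (N choose k))
      = 2 ^ N * (\<Sum>k\<le>N. \<bar>2 * real k - N\<bar> * B k)"
    unfolding sum_distrib_left by (intro sum.cong refl) (simp add: B)
  ultimately show ?thesis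
    by (simp add: r_def)
qed

text \<open>This is a d/da applied to (a + b)^(m+1). The binomial theorem for commuting elements is
  read off, degree by degree, from the exponential series of a + b.\<close>

lemma binomial_derivative_commuting:
  fixes a b :: "'a::{real_normed_algebra_1, banach}"
  assumes "a * b = b * a"
  shows "(\<Sum>k\<le>Suc m. (real k * real (Suc m choose k)) *\<^sub>R (a ^ k * b ^ (Suc m - k)))
    = real (Suc m) *\<^sub>R (a * (a + b) ^ m)"
proof -
  have binom: "(a + b) ^ m = (\<Sum>k\<le>m. real (m choose k) *\<^sub>R (a ^ k * b ^ (m - k)))"
  proof -
    have "(a + b) ^ m = fact m *\<^sub>R ((a + b) ^ m /\<^sub>R fact m)"
      by simp
    also have "(a + b) ^ m /\<^sub>R fact m = (\<Sum>k\<le>m. (a ^ k /\<^sub>R fact k) * (b ^ (m - k) /\<^sub>R fact (m - k)))"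
      by (rule exp_series_add_commuting[OF assms])
    also have "fact m *\<^sub>R \<dots> = (\<Sum>k\<le>m. real (m choose k) *\<^sub>R (a ^ k * b ^ (m - k)))"
      unfolding scaleR_sum_right by (intro sum.cong refl) (simp add: binomial_fact field_simps)
    finally show ?thesis .
  qed
  have "(\<Sum>k\<le>Suc m. (real k * real (Suc m choose k)) *\<^sub>R (a ^ k * b ^ (Suc m - k)))
      = (\<Sum>k\<le>m. (real (Suc k) * real (Suc m choose Suc k)) *\<^sub>R (a ^ Suc k * b ^ (m - k)))"
    by (subst sum.atMost_Suc_shift) (simp del: binomial_Suc_Suc)
  also have "\<dots> = (\<Sum>k\<le>m. real (Suc m) *\<^sub>R (a * (real (m choose k) *\<^sub>R (a ^ k * b ^ (m - k)))))"
    using Suc_times_binomial_eq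
    by (intro sum.cong refl) (simp add: mult.assoc del: binomial_Suc_Suc of_nat_Suc flip: of_nat_mult)
  finally show ?thesis
    by (simp add: binom sum_distrib_left scaleR_sum_right)
qed

text \<open>With \<open>a = 1 + c\<close> and \<open>b = 1 - c\<close>, expanding \<open>2 ^ m * (a - b) = (a - b) * (a + b) ^ m\<close>
  binomially leaves much cancellation between neighbouring coefficients.\<close>

lemma unit_extreme_point:
  fixes c :: "'a::{real_normed_algebra_1, banach}"
  assumes "norm (1 + c) \<le> 1" "norm (1 - c) \<le> 1"
  shows "c = 0"
proof -
  define a b where "a = 1 + c" and "b = 1 - c"
  have ab: "a * b = b * a" "a + b = 2" "a - b = 2 * c"
    by (auto simp: a_def b_def algebra_simps mult_2)
  have na: "norm (a ^ k) \<le> 1" and nb: "norm (b ^ k) \<le> 1" for k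
    using assms order.trans[OF norm_power_ineq power_le_one[OF norm_ge_zero]]
    by (auto simp: a_def b_def)
  \<comment> \<open>The trivial estimate of the weighted binomial sum would only bound
    \<open>norm c\<close> by 1. The deviation estimate gains the factor \<open>sqrt (Suc m)\<close>,
    and \<open>m\<close> is arbitrary.\<close>
  have bound: "norm c * sqrt (Suc m) \<le> 1" for m
  proof -
    define t where "t k = (real (Suc m choose k)) *\<^sub>R (a ^ k * b ^ (Suc m - k))" for k
    have sa: "(\<Sum>k\<le>Suc m. real k *\<^sub>R t k) = real (Suc m) *\<^sub>R (a * 2 ^ m)"
      using binomial_derivative_commuting[OF ab(1), of m] ab(2) by (simp add: t_def)
    have "(\<Sum>k\<le>Suc m. real (Suc m - k) *\<^sub>R t k) = real (Suc m) *\<^sub>R (b * 2 ^ m)"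
    proof -
      have "(\<Sum>k\<le>Suc m. real (Suc m - k) *\<^sub>R t k)
          = (\<Sum>k\<le>Suc m. real (Suc m - (Suc m - k)) *\<^sub>R t (Suc m - k))"
        by (rule sum.reindex_bij_witness[of _ "\<lambda>k. Suc m - k" "\<lambda>k. Suc m - k"]) auto
      also have "\<dots> = (\<Sum>k\<le>Suc m. (real k * real (Suc m choose k)) *\<^sub>R (b ^ k * a ^ (Suc m - k)))"
      proof (intro sum.cong refl)
        fix k assume k: "k \<in> {..Suc m}"
        have "a ^ (Suc m - k) * b ^ k = b ^ k * a ^ (Suc m - k)"
          using ab(1) by (metis power_commuting_commutes)
        thus "real (Suc m - (Suc m - k)) *\<^sub>R t (Suc m - k) =
          (real k * real (Suc m choose k)) *\<^sub>R (b ^ k * a ^ (Suc m - k))"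
          using k binomial_symmetric[of k "Suc m"] by (simp add: t_def del: binomial_Suc_Suc)
      qed
      finally show ?thesis
        using binomial_derivative_commuting[OF ab(1)[symmetric], of m] ab(2) by (simp add: add.commute)
    qed
    hence sb: "(\<Sum>k\<le>Suc m. (real (Suc m) - real k) *\<^sub>R t k) = real (Suc m) *\<^sub>R (b * 2 ^ m)"
      by (auto simp: of_nat_diff intro!: trans[OF sum.cong[OF refl]])
    have "(\<Sum>k\<le>Suc m. (2 * real k - real (Suc m)) *\<^sub>R t k)
        = real (Suc m) *\<^sub>R ((a - b) * 2 ^ m)"
      unfolding left_diff_distrib scaleR_diff_right sa[symmetric] sb[symmetric] sum_subtractf[symmetric]
      by (intro sum.cong refl) (simp add: algebra_simps flip: scaleR_add_left)
    also have "(a - b) * 2 ^ m = (2 ^ Suc m :: real) *\<^sub>R c"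
    proof -
      have "(2::'a) ^ m = (2 ^ m :: real) *\<^sub>R 1"
        using of_real_power[of "2::real" m, where ?'a = 'a] by (simp only: of_real_def[symmetric] of_real_numeral)
      moreover have "2 * c = (2 :: real) *\<^sub>R c"
        by (simp only: scaleR_2 mult_2)
      ultimately show ?thesis
        by (simp only: ab(3) mult_scaleR_right mult_1_right scaleR_scaleR power_Suc mult.commute)
    qed
    finally have "real (Suc m) * 2 ^ Suc m * norm c
        = norm (\<Sum>k\<le>Suc m. (2 * real k - real (Suc m)) *\<^sub>R t k)"
      by simp
    also have "\<dots> \<le> (\<Sum>k\<le>Suc m. \<bar>2 * real k - real (Suc m)\<bar> * real (Suc m choose k))"
    proof (rule sum_norm_le)
      fix k
      have "norm (a ^ k * b ^ (Suc m - k)) \<le> 1"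
        using norm_mult_ineq[of "a ^ k"] na nb by (meson mult_le_one norm_ge_zero order.trans)
      hence "norm (t k) \<le> real (Suc m choose k)"
        by (simp add: t_def mult_left_le del: binomial_Suc_Suc)
      thus "norm ((2 * real k - real (Suc m)) *\<^sub>R t k)
          \<le> \<bar>2 * real k - real (Suc m)\<bar> * real (Suc m choose k)"
        by (simp add: mult_left_mono del: binomial_Suc_Suc)
    qed
    also have "\<dots> \<le> 2 ^ Suc m * sqrt (Suc m)"
      by (rule binomial_diff_sum_le) simp
    finally have le: "real (Suc m) * 2 ^ Suc m * norm c \<le> 2 ^ Suc m * sqrt (Suc m)" .
    define r P where "r = sqrt (real (Suc m))" and "P = (2::real) ^ Suc m"
    have "real (Suc m) = r * r" "0 < P * r"
      by (auto simp: r_def P_def)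
    moreover from this le have "(P * r) * (norm c * r) \<le> (P * r) * 1"
      by (simp add: P_def[symmetric] r_def[symmetric] mult_ac del: of_nat_Suc power_Suc)
    ultimately show ?thesis
      by (subst (asm) mult_le_cancel_left_pos) (auto simp: r_def)
  qed
  show ?thesis
  proof (rule ccontr)
    assume "c \<noteq> 0"
    obtain m where m: "1 / (norm c)\<^sup>2 < real m"
      using reals_Archimedean2 by blast
    have "(norm c * sqrt (Suc m))\<^sup>2 \<le> 1"
      using bound[of m] by (simp add: abs_square_le_1)
    hence "(norm c)\<^sup>2 * Suc m \<le> 1"
      by (simp add: power_mult_distrib)
    moreover have "1 < (norm c)\<^sup>2 * real m"
      using m \<open>c \<noteq> 0\<close> by (simp add: field_simps)
    moreover have "(norm c)\<^sup>2 * real m \<le> (norm c)\<^sup>2 * Suc m"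
      by (intro mult_left_mono) auto
    ultimately show False
      by linarith
  qed
qed

section \<open>Cuntz families\<close>

definition words_of_length :: "nat \<Rightarrow> nat \<Rightarrow> nat list set" where
  "words_of_length n k = {\<mu> \<in> words n. length \<mu> = k}"

lemma finite_words_of_length [simp]: "finite (words_of_length n k)"
  using finite_lists_length_eq[of "{1..n}" k]
  by (auto simp: words_of_length_def words_def lists_eq_set conj_commute elim!: rev_finite_subset)

lemma words_of_length_0 [simp]: "words_of_length n 0 = {[]}"
  by (auto simp: words_of_length_def words_def)

lemma Nil_in_words [simp]: "[] \<in> words n"
  by (simp add: words_def)

lemma Cons_in_words_iff [simp]: "i # \<mu> \<in> words n \<longleftrightarrow> i \<in> {1..n} \<and> \<mu> \<in> words n"
  by (auto simp: words_def)

lemma append_in_words_iff [simp]: "\<mu> @ \<nu> \<in> words n \<longleftrightarrow> \<mu> \<in> words n \<and> \<nu> \<in> words n"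
  by (auto simp: words_def)

lemma words_of_length_Suc:
  "words_of_length n (Suc k) = (\<lambda>(i, \<mu>). i # \<mu>) ` ({1..n} \<times> words_of_length n k)"
  by (fastforce simp: words_of_length_def length_Suc_conv image_iff)

lemma word_isometry_Nil [simp]: "word_isometry S [] = 1"
  by (simp add: word_isometry_def)

lemma word_isometry_Cons [simp]: "word_isometry S (i # \<mu>) = S i * word_isometry S \<mu>"
  by (simp add: word_isometry_def)

lemma word_isometry_append: "word_isometry S (\<mu> @ \<nu>) = word_isometry S \<mu> * word_isometry S \<nu>"
  by (simp add: word_isometry_def)

locale cuntz_family =
  fixes n :: nat and S :: "nat \<Rightarrow> 'a::unital_cstar_algebra"
  assumes n_ge_2: "2 \<le> n"
    and isometry: "i \<in> {1..n} \<Longrightarrow> (S i)\<^sup>\<star> * S i = 1"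
    and sum_ranges: "(\<Sum>i=1..n. S i * (S i)\<^sup>\<star>) = 1"
begin

text \<open>The compressions \<open>c i\<close> of the range projections by \<open>S j\<close> sum up to \<open>0\<close> over the \<open>m\<close> indices
  \<open>i \<noteq> j\<close>. Since \<open>1 - c i\<close> is a contraction, so are \<open>1 \<plusminus> c i / m\<close>, and extremality of the unit yields \<open>c i = 0\<close>.
  This replaces positivity of \<open>x\<^sup>\<star> * x\<close>.\<close>

lemma ranges_orthogonal:
  assumes ij: "i \<in> {1..n}" "j \<in> {1..n}" "i \<noteq> j"
  shows "(S i)\<^sup>\<star> * S j = 0"
proof -
  define c where "c k = (S j)\<^sup>\<star> * (S k * (S k)\<^sup>\<star>) * S j" for k
  define I where "I = {1..n} - {j}"
  define m where "m = card I"
  have I: "finite I" "i \<in> I" and m: "0 < m"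
    using ij by (auto simp: I_def m_def card_gt_0_iff)
  have "(\<Sum>k=1..n. c k) = (S j)\<^sup>\<star> * (\<Sum>k=1..n. S k * (S k)\<^sup>\<star>) * S j"
    unfolding c_def sum_distrib_left sum_distrib_right ..
  also have "\<dots> = 1"
    using isometry[OF ij(2)] by (simp only: sum_ranges mult_1_right)
  finally have "c j + sum c I = 1"
    unfolding I_def using ij sum.remove[of "{1..n}" j c] by simp
  moreover have "c j = ((S j)\<^sup>\<star> * S j) * ((S j)\<^sup>\<star> * S j)"
    by (simp only: c_def mult.assoc)
  hence "c j = 1"
    using ij isometry by simp
  ultimately have sum0: "sum c I = 0"
    by simp
  have le: "norm (1 - c k) \<le> 1" if "k \<in> I" for k
  proof -
    have k: "k \<in> {1..n}" using that by (simp add: I_def)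
    let ?p = "S k * (S k)\<^sup>\<star>"
    have "1 - c k = (S j)\<^sup>\<star> * (1 - ?p) * S j"
      using isometry[OF ij(2)] by (simp add: c_def algebra_simps)
    moreover have "norm (1 - ?p) \<le> 1"
    proof (rule norm_projection_le_1)
      show "(1 - ?p)\<^sup>\<star> = 1 - ?p"
        by (simp add: star_diff star_mult star_star)
      have "?p * ?p = S k * ((S k)\<^sup>\<star> * S k) * (S k)\<^sup>\<star>"
        by (simp only: mult.assoc)
      hence "?p * ?p = ?p"
        using isometry[OF k] by simp
      thus "(1 - ?p) * (1 - ?p) = 1 - ?p"
        by (simp add: algebra_simps)
    qed
    moreover have "norm (S j) \<le> 1"
      using norm_isometry[OF isometry[OF ij(2)]] by simp
    ultimately show ?thesis
      using norm_compression_le[of "S j" "S j" "1 - ?p"] by simp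
  qed
  have rescale: "norm (1 + t /\<^sub>R real m) \<le> 1" if "norm (real m *\<^sub>R 1 + t) \<le> real m" for t :: 'a
  proof -
    have "1 + t /\<^sub>R real m = (real m *\<^sub>R 1 + t) /\<^sub>R real m"
      using m by (simp add: scaleR_add_right)
    hence "norm (1 + t /\<^sub>R real m) = norm (real m *\<^sub>R 1 + t) / real m"
      by (simp only: norm_scaleR) (simp add: divide_inverse mult.commute)
    thus ?thesis
      using that m by (simp only: divide_le_eq_1) auto
  qed
  have "norm (real m *\<^sub>R 1 + c i) \<le> real m"
  proof -
    \<comment> \<open>As the \<open>c k\<close> sum to 0 over \<open>I\<close>, m +
      \<open>c i\<close> is the unit plus m - 1 contractions. For the other sign, m -
      \<open>c i\<close> is m - 1 times the unit plus a single contraction.\<close>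
    have "(\<Sum>k\<in>I - {i}. 1 - c k) = real (m - 1) *\<^sub>R 1 + c i"
      using sum0 I by (simp add: sum_subtractf sum.remove m_def scaleR_conv_of_real add_eq_0_iff)
    hence eq: "real m *\<^sub>R 1 + c i = 1 + (\<Sum>k\<in>I - {i}. 1 - c k)"
      using m by (simp add: of_nat_diff scaleR_conv_of_real)
    have "norm (\<Sum>k\<in>I - {i}. 1 - c k) \<le> (\<Sum>k\<in>I - {i}. 1)"
      by (rule sum_norm_le) (use le in auto)
    also have "\<dots> = real m - 1"
      using I m by (simp add: m_def of_nat_diff)
    finally show ?thesis
      unfolding eq using norm_triangle_ineq[of 1 "\<Sum>k\<in>I - {i}. 1 - c k"] by simp
  qed
  from rescale[OF this] have 1: "norm (1 + c i /\<^sub>R real m) \<le> 1" .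
  have "norm (real m *\<^sub>R 1 - c i) \<le> real m"
  proof -
    have "real m *\<^sub>R 1 - c i = (real m - 1) *\<^sub>R 1 + (1 - c i)"
      by (simp add: algebra_simps)
    hence "norm (real m *\<^sub>R 1 - c i) \<le> norm ((real m - 1) *\<^sub>R (1::'a)) + norm (1 - c i)"
      by (metis norm_triangle_ineq)
    thus ?thesis
      using le[OF I(2)] m by simp
  qed
  hence 2: "norm (1 - c i /\<^sub>R real m) \<le> 1"
    using rescale[of "- c i"] by simp
  have "c i = 0"
    using unit_extreme_point[OF 1 2] m by simp
  hence "((S i)\<^sup>\<star> * S j)\<^sup>\<star> * ((S i)\<^sup>\<star> * S j) = 0"
    by (simp add: c_def star_mult star_star mult.assoc)
  thus ?thesis
    by (simp only: star_mult_self_eq_0_iff)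
qed

lemma generator_star_mult:
  assumes "i \<in> {1..n}" "j \<in> {1..n}"
  shows "(S i)\<^sup>\<star> * S j = (if i = j then 1 else 0)"
  using assms isometry ranges_orthogonal by auto

lemma generator_star_mult_assoc:
  assumes "i \<in> {1..n}" "j \<in> {1..n}"
  shows "(S i)\<^sup>\<star> * (S j * x) = (if i = j then x else 0)"
  using generator_star_mult[OF assms] by (simp flip: mult.assoc)

lemma one_n_in [simp]: "Suc 0 \<in> {1..n}" "n \<in> {1..n}" "Suc 0 \<le> n" "n \<noteq> Suc 0" "Suc 0 \<noteq> n"
  using n_ge_2 by auto

lemma word_star_mult:
  assumes "\<mu> \<in> words n" "\<nu> \<in> words n" "length \<mu> = length \<nu>"
  shows "(word_isometry S \<mu>)\<^sup>\<star> * word_isometry S \<nu> = (if \<mu> = \<nu> then 1 else 0)"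
  using assms(3,1,2)
  by (induction rule: list_induct2) (auto simp: star_mult mult.assoc generator_star_mult_assoc)

lemma norm_word_le: "\<mu> \<in> words n \<Longrightarrow> norm (word_isometry S \<mu>) \<le> 1"
  using norm_isometry[of "word_isometry S \<mu>"] word_star_mult[of \<mu> \<mu>] by simp

lemma word_sum_ranges:
  "(\<Sum>\<mu>\<in>words_of_length n k. word_isometry S \<mu> * (word_isometry S \<mu>)\<^sup>\<star>) = 1"
proof (induction k)
  case (Suc k)
  have inj: "inj_on (\<lambda>(i::nat, \<mu>). i # \<mu>) ({1..n} \<times> words_of_length n k)"
    by (auto simp: inj_on_def)
  have "(\<Sum>\<mu>\<in>words_of_length n (Suc k). word_isometry S \<mu> * (word_isometry S \<mu>)\<^sup>\<star>)
    = (\<Sum>i=1..n. \<Sum>\<mu>\<in>words_of_length n k. S i * (word_isometry S \<mu> * (word_isometry S \<mu>)\<^sup>\<star>) * (S i)\<^sup>\<star>)"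
    by (subst words_of_length_Suc, subst sum.reindex[OF inj])
      (simp add: sum.cartesian_product star_mult mult.assoc case_prod_unfold)
  also have "\<dots> = 1"
    using sum_ranges by (simp add: Suc flip: sum_distrib_left sum_distrib_right)
  finally show ?case .
qed simp

text \<open>Equal first letters cancel. A mismatch gives 0 by orthogonality of the ranges; if one
  word runs out first, \<delta> is what remains of the other.\<close>

lemma word_star_mult_cases:
  assumes "\<alpha> \<in> words n" "\<beta> \<in> words n"
  obtains "(word_isometry S \<alpha>)\<^sup>\<star> * word_isometry S \<beta> = 0"
  | \<delta> where "\<beta> = \<alpha> @ \<delta>" "(word_isometry S \<alpha>)\<^sup>\<star> * word_isometry S \<beta> = word_isometry S \<delta>"
  | \<delta> where "\<alpha> = \<beta> @ \<delta>" "(word_isometry S \<alpha>)\<^sup>\<star> * word_isometry S \<beta> = (word_isometry S \<delta>)\<^sup>\<star>"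
  using assms
proof (induction \<alpha> arbitrary: \<beta> thesis)
  case (Cons i \<alpha>)
  show ?case
  proof (cases \<beta>)
    case Nil
    thus ?thesis
      using Cons.prems(3)[of "i # \<alpha>"] by simp
  next
    case (Cons j \<beta>')
    show ?thesis
    proof (cases "i = j")
      case False
      thus ?thesis
        using Cons.prems Cons by (auto simp: star_mult mult.assoc generator_star_mult_assoc)
    next
      case True
      hence eq: "(word_isometry S (i # \<alpha>))\<^sup>\<star> * word_isometry S \<beta> = (word_isometry S \<alpha>)\<^sup>\<star> * word_isometry S \<beta>'"
        using Cons.prems(4,5) Cons by (auto simp: star_mult mult.assoc generator_star_mult_assoc)
      have \<beta>: "\<beta> = i # \<beta>'" and words: "\<alpha> \<in> words n" "\<beta>' \<in> words n"
        using True Cons Cons.prems(4,5) by auto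
      show ?thesis
      proof (rule Cons.IH[OF _ _ _ words])
        fix \<delta> assume "\<beta>' = \<alpha> @ \<delta>" "(word_isometry S \<alpha>)\<^sup>\<star> * word_isometry S \<beta>' = word_isometry S \<delta>"
        with Cons.prems(2)[of \<delta>] eq \<beta> show thesis by simp
      next
        fix \<delta> assume "\<alpha> = \<beta>' @ \<delta>" "(word_isometry S \<alpha>)\<^sup>\<star> * word_isometry S \<beta>' = (word_isometry S \<delta>)\<^sup>\<star>"
        with Cons.prems(3)[of \<delta>] eq \<beta> show thesis by simp
      qed (use Cons.prems(1) eq in \<open>simp only:\<close>)
    qed
  qed
qed auto

text \<open>The power of \<open>(S i)\<^sup>\<star>\<close> reads the letters of \<mu> one by one
  and vanishes at the first letter other than \<open>i\<close>.\<close>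

lemma word_star_replicate:
  assumes "\<mu> \<in> words n" "i \<in> {1..n}" "length \<mu> \<le> N"
  shows "(S i)\<^sup>\<star> ^ N * word_isometry S \<mu> =
    (if \<mu> = replicate (length \<mu>) i then (S i)\<^sup>\<star> ^ (N - length \<mu>) else 0)"
  using assms
proof (induction \<mu> arbitrary: N)
  case (Cons j \<mu>)
  then obtain M where M: "N = Suc M" by (cases N) auto
  have "(S i)\<^sup>\<star> ^ N * word_isometry S (j # \<mu>) = (S i)\<^sup>\<star> ^ M * ((S i)\<^sup>\<star> * (S j * word_isometry S \<mu>))"
    by (simp add: M mult.assoc power_Suc2 del: power_Suc)
  thus ?case
    using Cons M by (auto simp: generator_star_mult_assoc)
qed simp

lemma star_power_mult_power:
  assumes "i \<in> {1..n}"
  shows "(S i)\<^sup>\<star> ^ N * S i ^ k = (if k \<le> N then (S i)\<^sup>\<star> ^ (N - k) else S i ^ (k - N))"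
proof -
  have eq: "(S i)\<^sup>\<star> ^ m * S i ^ m = 1" for m
  proof (induction m)
    case (Suc m)
    have "(S i)\<^sup>\<star> ^ Suc m * S i ^ Suc m = (S i)\<^sup>\<star> ^ m * ((S i)\<^sup>\<star> * S i) * S i ^ m"
      by (simp add: power_Suc2[of "(S i)\<^sup>\<star>"] mult.assoc del: power_Suc)
        (simp add: mult.assoc)
    thus ?case
      using isometry[OF assms] Suc by simp
  qed simp
  show ?thesis
  proof (cases "k \<le> N")
    case True
    hence "(S i)\<^sup>\<star> ^ N = (S i)\<^sup>\<star> ^ (N - k) * (S i)\<^sup>\<star> ^ k"
      by (simp flip: power_add)
    thus ?thesis
      using eq[of k] True by (simp add: mult.assoc)
  next
    case False
    hence "S i ^ k = S i ^ N * S i ^ (k - N)"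
      by (simp flip: power_add)
    thus ?thesis
      using eq[of N] False by (simp flip: mult.assoc)
  qed
qed

end

section \<open>Uniqueness of the Cuntz algebra\<close>

lemma words_of_length_iff: "\<mu> \<in> words_of_length n k \<longleftrightarrow> \<mu> \<in> words n \<and> length \<mu> = k"
  by (simp add: words_of_length_def)

lemma words_of_length_Suc_snocE:
  assumes "\<mu> \<in> words_of_length n (Suc k)"
  obtains \<mu>' i where "\<mu> = \<mu>' @ [i]" "\<mu>' \<in> words_of_length n k" "i \<in> {1..n}"
  using assms by (cases \<mu> rule: rev_cases) (auto simp: words_of_length_iff)

context cuntz_family
begin

lemma word_star_mult_self [simp]: "\<mu> \<in> words n \<Longrightarrow> (word_isometry S \<mu>)\<^sup>\<star> * word_isometry S \<mu> = 1"
  by (simp add: word_star_mult)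

text \<open>Insert the partitions of unity of lengths \<open>p\<close> and \<open>q\<close>; the
  inner compressions play the role of matrix entries of \<open>x\<close>.\<close>

lemma word_decomposition:
  "x = (\<Sum>\<mu>\<in>words_of_length n p. \<Sum>\<nu>\<in>words_of_length n q.
      word_isometry S \<mu> * ((word_isometry S \<mu>)\<^sup>\<star> * x * word_isometry S \<nu>) * (word_isometry S \<nu>)\<^sup>\<star>)"
proof -
  have "x = (\<Sum>\<mu>\<in>words_of_length n p. word_isometry S \<mu> * (word_isometry S \<mu>)\<^sup>\<star>) * x *
      (\<Sum>\<nu>\<in>words_of_length n q. word_isometry S \<nu> * (word_isometry S \<nu>)\<^sup>\<star>)"
    by (simp add: word_sum_ranges)
  also have "\<dots> = (\<Sum>\<nu>\<in>words_of_length n q. \<Sum>\<mu>\<in>words_of_length n p.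
      word_isometry S \<mu> * ((word_isometry S \<mu>)\<^sup>\<star> * x * word_isometry S \<nu>) * (word_isometry S \<nu>)\<^sup>\<star>)"
    by (simp only: sum_distrib_left sum_distrib_right mult.assoc)
  also have "\<dots> = (\<Sum>\<mu>\<in>words_of_length n p. \<Sum>\<nu>\<in>words_of_length n q.
      word_isometry S \<mu> * ((word_isometry S \<mu>)\<^sup>\<star> * x * word_isometry S \<nu>) * (word_isometry S \<nu>)\<^sup>\<star>)"
    by (rule sum.swap)
  finally show ?thesis .
qed

text \<open>Cuntz' trick: \<open>spread J p\<close> is an isometry such that compressing by \<open>spread J p\<close> and
  \<open>spread J q\<close> fixes \<open>S\<^sub>\<mu>S\<^sub>\<nu>\<^sup>\<star>\<close> with \<open>|\<mu>| = p\<close>, \<open>|\<nu>| = q\<close>, and kills the terms whose degree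
  differs from \<open>p - q\<close> by at most \<open>J\<close>, as the word \<open>1\<^sup>Jn\<close> overlaps itself only trivially.\<close>

definition probe :: "nat \<Rightarrow> 'a" where
  "probe J = S 1 ^ J * S n"

definition spread :: "nat \<Rightarrow> nat \<Rightarrow> 'a" where
  "spread J p = (\<Sum>\<mu>\<in>words_of_length n p. word_isometry S \<mu> * probe J * (word_isometry S \<mu>)\<^sup>\<star>)"

lemma probe_isometry: "(probe J)\<^sup>\<star> * probe J = 1"
proof -
  have "(probe J)\<^sup>\<star> * probe J = (S n)\<^sup>\<star> * ((S 1)\<^sup>\<star> ^ J * S 1 ^ J) * S n"
    by (simp only: probe_def star_mult star_power mult.assoc)
  thus ?thesis
    using star_power_mult_power[of 1 J J] isometry[of n] by simp
qed

text \<open>Only \<delta> = 1...1 survives \<open>(S 1)\<^sup>\<star> ^ J\<close>, and then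
  \<open>S 1 ^ length \<delta>\<close> is left over. Its first letter is 1 because \<delta> is
  nonempty, so \<open>(S n)\<^sup>\<star>\<close> kills it.\<close>

lemma probe_compress_word:
  assumes "\<delta> \<in> words n" "0 < length \<delta>" "length \<delta> \<le> J"
  shows "(probe J)\<^sup>\<star> * word_isometry S \<delta> * probe J = 0"
proof -
  have "(probe J)\<^sup>\<star> * word_isometry S \<delta> * probe J
      = (S n)\<^sup>\<star> * (((S 1)\<^sup>\<star> ^ J * word_isometry S \<delta>) * S 1 ^ J) * S n"
    by (simp only: probe_def star_mult star_power mult.assoc)
  also have "\<dots> = 0"
  proof -
    have "(S 1)\<^sup>\<star> ^ J * word_isometry S \<delta> * S 1 ^ J = 0 \<or>
        (S 1)\<^sup>\<star> ^ J * word_isometry S \<delta> * S 1 ^ J = S 1 ^ length \<delta>"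
    proof -
      have "\<not> J \<le> J - length \<delta>" "J - (J - length \<delta>) = length \<delta>"
        using assms by linarith+
      thus ?thesis
        using assms word_star_replicate[of \<delta> 1 J] star_power_mult_power[of 1 "J - length \<delta>" J] by simp
    qed
    thus "(S n)\<^sup>\<star> * (((S 1)\<^sup>\<star> ^ J * word_isometry S \<delta>) * S 1 ^ J) * S n = 0"
    proof
      assume eq: "(S 1)\<^sup>\<star> ^ J * word_isometry S \<delta> * S 1 ^ J = S 1 ^ length \<delta>"
      have "(S n)\<^sup>\<star> * S 1 ^ length \<delta> = (S n)\<^sup>\<star> * (S 1 * S 1 ^ (length \<delta> - 1))"
        using assms(2) by (simp flip: power_Suc)
      also have "\<dots> = 0"
        by (subst generator_star_mult_assoc) auto
      finally show ?thesis
        unfolding eq by simp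
    qed simp
  qed
  finally show ?thesis .
qed

text \<open>\<open>spread J p\<close> is the p-fold iterate of \<open>x \<mapsto> \<Sum>\<^sub>i
  S\<^sub>i x S\<^sub>i\<^sup>\<star>\<close> at \<open>probe J\<close>, so a word of length
  \<open>p\<close> moves through it and leaves the probe behind.\<close>

lemma spread_star_mult_word:
  assumes "\<mu> \<in> words_of_length n p"
  shows "(spread J p)\<^sup>\<star> * word_isometry S \<mu> = word_isometry S \<mu> * (probe J)\<^sup>\<star>"
proof -
  have "(spread J p)\<^sup>\<star> * word_isometry S \<mu> =
     (\<Sum>\<kappa>\<in>words_of_length n p. word_isometry S \<kappa> * (probe J)\<^sup>\<star> * ((word_isometry S \<kappa>)\<^sup>\<star> * word_isometry S \<mu>))"
    by (simp add: spread_def star_sum star_mult star_star sum_distrib_right mult.assoc)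
  also have "\<dots> = (\<Sum>\<kappa>\<in>words_of_length n p. if \<kappa> = \<mu> then word_isometry S \<kappa> * (probe J)\<^sup>\<star> else 0)"
    by (intro sum.cong refl) (use assms in \<open>auto simp: word_star_mult words_of_length_iff\<close>)
  finally show ?thesis
    using assms by simp
qed

lemma word_star_mult_spread:
  assumes "\<mu> \<in> words_of_length n p"
  shows "(word_isometry S \<mu>)\<^sup>\<star> * spread J p = probe J * (word_isometry S \<mu>)\<^sup>\<star>"
  using arg_cong[OF spread_star_mult_word[OF assms, of J], of star] by (simp add: star_mult star_star)

lemma spread_isometry: "(spread J p)\<^sup>\<star> * spread J p = 1"
proof -
  have "(spread J p)\<^sup>\<star> * spread J p
      = (\<Sum>\<mu>\<in>words_of_length n p. ((spread J p)\<^sup>\<star> * word_isometry S \<mu>) * probe J * (word_isometry S \<mu>)\<^sup>\<star>)"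
    by (simp add: spread_def[of J p, THEN arg_cong[where f = "(*) _"]] sum_distrib_left mult.assoc)
  also have "\<dots> = (\<Sum>\<mu>\<in>words_of_length n p. word_isometry S \<mu> * (word_isometry S \<mu>)\<^sup>\<star>)"
  proof (intro sum.cong refl)
    fix \<mu> assume "\<mu> \<in> words_of_length n p"
    hence "(spread J p)\<^sup>\<star> * word_isometry S \<mu> * probe J = word_isometry S \<mu> * ((probe J)\<^sup>\<star> * probe J)"
      by (simp add: spread_star_mult_word mult.assoc)
    thus "(spread J p)\<^sup>\<star> * word_isometry S \<mu> * probe J * (word_isometry S \<mu>)\<^sup>\<star> =
        word_isometry S \<mu> * (word_isometry S \<mu>)\<^sup>\<star>"
      by (simp add: probe_isometry)
  qed
  finally show ?thesis
    by (simp add: word_sum_ranges)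
qed

lemma spread_compress_word:
  assumes "\<mu> \<in> words_of_length n p'" "\<nu> \<in> words_of_length n q" "p \<le> p' + J" "p' \<le> p + J"
  shows "(spread J p)\<^sup>\<star> * (word_isometry S \<mu> * (word_isometry S \<nu>)\<^sup>\<star>) * spread J q =
    (if p = p' then word_isometry S \<mu> * (word_isometry S \<nu>)\<^sup>\<star> else 0)"
proof -
  have eq: "(spread J p)\<^sup>\<star> * (word_isometry S \<mu> * (word_isometry S \<nu>)\<^sup>\<star>) * spread J q =
      (spread J p)\<^sup>\<star> * word_isometry S \<mu> * probe J * (word_isometry S \<nu>)\<^sup>\<star>"
    using word_star_mult_spread[OF assms(2)] by (simp add: mult.assoc)
  show ?thesis
  proof (cases "p = p'")
    case True
    have "(spread J p)\<^sup>\<star> * word_isometry S \<mu> * probe J = word_isometry S \<mu> * ((probe J)\<^sup>\<star> * probe J)"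
      using assms(1) True by (simp add: spread_star_mult_word mult.assoc)
    thus ?thesis
      unfolding eq by (simp add: probe_isometry True)
  next
    case False
    \<comment> \<open>The lengths \<open>p\<close> and \<open>p'\<close> differ by at least 1 and at
      most \<open>J\<close>. Hence the inner product of the two words is 0, or a word of such a
      length, or the adjoint of one, and the probe kills all of these.\<close>
    have "(probe J)\<^sup>\<star> * ((word_isometry S \<kappa>)\<^sup>\<star> * word_isometry S \<mu>) * probe J = 0"
      if \<kappa>: "\<kappa> \<in> words_of_length n p" for \<kappa>
    proof -
      have words: "\<kappa> \<in> words n" "\<mu> \<in> words n"
        using \<kappa> assms(1) by (auto simp: words_of_length_iff)
      show ?thesis
      proof (cases rule: word_star_mult_cases[OF words])
        case (2 \<delta>)
        thus ?thesis
          using words \<kappa> assms False by (auto simp: words_of_length_iff intro!: probe_compress_word)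
      next
        case (3 \<delta>)
        hence "(probe J)\<^sup>\<star> * word_isometry S \<delta> * probe J = 0"
          using words \<kappa> assms False by (intro probe_compress_word) (auto simp: words_of_length_iff)
        from arg_cong[OF this, of star] show ?thesis
          using 3(2) by (simp add: star_mult star_star mult.assoc)
      qed simp
    qed
    hence "(\<Sum>\<kappa>\<in>words_of_length n p. word_isometry S \<kappa> *
        ((probe J)\<^sup>\<star> * ((word_isometry S \<kappa>)\<^sup>\<star> * word_isometry S \<mu>) * probe J)) = 0"
      by simp
    hence "(spread J p)\<^sup>\<star> * word_isometry S \<mu> * probe J = 0"
      by (simp add: spread_def star_sum star_mult star_star sum_distrib_right mult.assoc)
    thus ?thesis
      unfolding eq using False by simp
  qed
qed

end

section \<open>Comparison of the polynomials in two Cuntz families\<close>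

locale cuntz_family_pair = S: cuntz_family n S + T: cuntz_family n T
  for n :: nat and S :: "nat \<Rightarrow> 'a::unital_cstar_algebra" and T :: "nat \<Rightarrow> 'b::unital_cstar_algebra"
begin

text \<open>\<open>x\<close> and \<open>y\<close> are the same linear combination of the words \<open>S\<^sub>\<mu>S\<^sub>\<nu>\<^sup>\<star>\<close> and \<open>T\<^sub>\<mu>T\<^sub>\<nu>\<^sup>\<star>\<close> with
  \<open>|\<mu>| = p\<close> and \<open>|\<nu>| = q\<close>, expressed through matrix coefficients.\<close>

definition same_matrix :: "nat \<Rightarrow> nat \<Rightarrow> 'a \<Rightarrow> 'b \<Rightarrow> bool" where
  "same_matrix p q x y \<longleftrightarrow> (\<forall>\<mu>\<in>words_of_length n p. \<forall>\<nu>\<in>words_of_length n q. \<exists>c.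
     (word_isometry S \<mu>)\<^sup>\<star> * x * word_isometry S \<nu> = c *\<^sub>C 1 \<and>
     (word_isometry T \<mu>)\<^sup>\<star> * y * word_isometry T \<nu> = c *\<^sub>C 1)"

lemma same_matrix_coeffsE:
  assumes "same_matrix p q x y"
  obtains c where
    "\<And>\<mu> \<nu>. \<mu> \<in> words_of_length n p \<Longrightarrow> \<nu> \<in> words_of_length n q \<Longrightarrow>
      (word_isometry S \<mu>)\<^sup>\<star> * x * word_isometry S \<nu> = c \<mu> \<nu> *\<^sub>C 1"
    "\<And>\<mu> \<nu>. \<mu> \<in> words_of_length n p \<Longrightarrow> \<nu> \<in> words_of_length n q \<Longrightarrow>
      (word_isometry T \<mu>)\<^sup>\<star> * y * word_isometry T \<nu> = c \<mu> \<nu> *\<^sub>C 1"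
  using assms unfolding same_matrix_def by metis

lemma same_matrix_0: "same_matrix p q 0 0"
  by (auto simp: same_matrix_def intro!: exI[of _ 0])

lemma same_matrix_add:
  assumes "same_matrix p q x y" "same_matrix p q x' y'"
  shows "same_matrix p q (x + x') (y + y')"
  unfolding same_matrix_def
proof (intro ballI)
  fix \<mu> \<nu> assume *: "\<mu> \<in> words_of_length n p" "\<nu> \<in> words_of_length n q"
  obtain c where c: "(word_isometry S \<mu>)\<^sup>\<star> * x * word_isometry S \<nu> = c *\<^sub>C 1"
     "(word_isometry T \<mu>)\<^sup>\<star> * y * word_isometry T \<nu> = c *\<^sub>C 1"
    using assms(1) * unfolding same_matrix_def by blast
  obtain d where d: "(word_isometry S \<mu>)\<^sup>\<star> * x' * word_isometry S \<nu> = d *\<^sub>C 1"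
     "(word_isometry T \<mu>)\<^sup>\<star> * y' * word_isometry T \<nu> = d *\<^sub>C 1"
    using assms(2) * unfolding same_matrix_def by blast
  show "\<exists>c. (word_isometry S \<mu>)\<^sup>\<star> * (x + x') * word_isometry S \<nu> = c *\<^sub>C 1 \<and>
     (word_isometry T \<mu>)\<^sup>\<star> * (y + y') * word_isometry T \<nu> = c *\<^sub>C 1"
    by (rule exI[of _ "c + d"]) (simp add: distrib_left distrib_right c d scaleC_add_left)
qed

lemma same_matrix_scaleC:
  assumes "same_matrix p q x y"
  shows "same_matrix p q (a *\<^sub>C x) (a *\<^sub>C y)"
  unfolding same_matrix_def
proof (intro ballI)
  fix \<mu> \<nu> assume *: "\<mu> \<in> words_of_length n p" "\<nu> \<in> words_of_length n q"
  obtain c where c: "(word_isometry S \<mu>)\<^sup>\<star> * x * word_isometry S \<nu> = c *\<^sub>C 1"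
     "(word_isometry T \<mu>)\<^sup>\<star> * y * word_isometry T \<nu> = c *\<^sub>C 1"
    using assms(1) * unfolding same_matrix_def by blast
  show "\<exists>c. (word_isometry S \<mu>)\<^sup>\<star> * (a *\<^sub>C x) * word_isometry S \<nu> = c *\<^sub>C 1 \<and>
     (word_isometry T \<mu>)\<^sup>\<star> * (a *\<^sub>C y) * word_isometry T \<nu> = c *\<^sub>C 1"
    by (rule exI[of _ "a * c"]) (simp add: mult_scaleC_left mult_scaleC_right c scaleC_scaleC)
qed

lemma same_matrix_star:
  assumes "same_matrix p q x y"
  shows "same_matrix q p (x\<^sup>\<star>) (y\<^sup>\<star>)"
  unfolding same_matrix_def
proof (intro ballI)
  fix \<nu> \<mu> assume *: "\<nu> \<in> words_of_length n q" "\<mu> \<in> words_of_length n p"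
  obtain c where c: "(word_isometry S \<mu>)\<^sup>\<star> * x * word_isometry S \<nu> = c *\<^sub>C 1"
     "(word_isometry T \<mu>)\<^sup>\<star> * y * word_isometry T \<nu> = c *\<^sub>C 1"
    using assms(1) * unfolding same_matrix_def by blast
  show "\<exists>c. (word_isometry S \<nu>)\<^sup>\<star> * x\<^sup>\<star> * word_isometry S \<mu> = c *\<^sub>C 1 \<and>
     (word_isometry T \<nu>)\<^sup>\<star> * y\<^sup>\<star> * word_isometry T \<mu> = c *\<^sub>C 1"
    using arg_cong[OF c(1), of star] arg_cong[OF c(2), of star]
    by (intro exI[of _ "cnj c"]) (simp add: star_mult star_star star_scaleC mult.assoc)
qed

lemma same_matrix_mult:
  assumes "same_matrix p q x y" "same_matrix q r x' y'"
  shows "same_matrix p r (x * x') (y * y')"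
  unfolding same_matrix_def
proof (intro ballI)
  fix \<mu> \<nu> assume *: "\<mu> \<in> words_of_length n p" "\<nu> \<in> words_of_length n r"
  obtain c where c: "\<And>\<kappa>. \<kappa> \<in> words_of_length n q \<Longrightarrow> (word_isometry S \<mu>)\<^sup>\<star> * x * word_isometry S \<kappa> = c \<kappa> *\<^sub>C 1"
     "\<And>\<kappa>. \<kappa> \<in> words_of_length n q \<Longrightarrow> (word_isometry T \<mu>)\<^sup>\<star> * y * word_isometry T \<kappa> = c \<kappa> *\<^sub>C 1"
    using same_matrix_coeffsE[OF assms(1)] * by metis
  obtain d where d: "\<And>\<kappa>. \<kappa> \<in> words_of_length n q \<Longrightarrow> (word_isometry S \<kappa>)\<^sup>\<star> * x' * word_isometry S \<nu> = d \<kappa> *\<^sub>C 1"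
     "\<And>\<kappa>. \<kappa> \<in> words_of_length n q \<Longrightarrow> (word_isometry T \<kappa>)\<^sup>\<star> * y' * word_isometry T \<nu> = d \<kappa> *\<^sub>C 1"
  proof (rule same_matrix_coeffsE[OF assms(2)])
    fix d assume "\<And>\<mu> \<nu>. \<mu> \<in> words_of_length n q \<Longrightarrow> \<nu> \<in> words_of_length n r \<Longrightarrow>
        (word_isometry S \<mu>)\<^sup>\<star> * x' * word_isometry S \<nu> = d \<mu> \<nu> *\<^sub>C 1"
      "\<And>\<mu> \<nu>. \<mu> \<in> words_of_length n q \<Longrightarrow> \<nu> \<in> words_of_length n r \<Longrightarrow>
        (word_isometry T \<mu>)\<^sup>\<star> * y' * word_isometry T \<nu> = d \<mu> \<nu> *\<^sub>C 1"
    thus thesis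
      using * that[of "\<lambda>\<kappa>. d \<kappa> \<nu>"] by blast
  qed
  \<comment> \<open>An entry of the matrix product; the inner index is the word inserted by the
    partition of unity of length \<open>q\<close>.\<close>
  let ?e = "\<Sum>\<kappa>\<in>words_of_length n q. c \<kappa> * d \<kappa>"
  have "(word_isometry S \<mu>)\<^sup>\<star> * (x * x') * word_isometry S \<nu> = (word_isometry S \<mu>)\<^sup>\<star> * x *
      (\<Sum>\<kappa>\<in>words_of_length n q. word_isometry S \<kappa> * (word_isometry S \<kappa>)\<^sup>\<star>) * (x' * word_isometry S \<nu>)"
    by (simp add: S.word_sum_ranges mult.assoc)
  also have "\<dots> = (\<Sum>\<kappa>\<in>words_of_length n q. ((word_isometry S \<mu>)\<^sup>\<star> * x * word_isometry S \<kappa>) *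
      ((word_isometry S \<kappa>)\<^sup>\<star> * x' * word_isometry S \<nu>))"
    by (simp only: sum_distrib_left sum_distrib_right mult.assoc)
  also have "\<dots> = ?e *\<^sub>C 1"
    unfolding complex_vector.scale_sum_left
    by (intro sum.cong refl) (simp add: c d mult_scaleC_left scaleC_scaleC)
  finally have 1: "(word_isometry S \<mu>)\<^sup>\<star> * (x * x') * word_isometry S \<nu> = ?e *\<^sub>C 1" .
  have "(word_isometry T \<mu>)\<^sup>\<star> * (y * y') * word_isometry T \<nu> = (word_isometry T \<mu>)\<^sup>\<star> * y *
      (\<Sum>\<kappa>\<in>words_of_length n q. word_isometry T \<kappa> * (word_isometry T \<kappa>)\<^sup>\<star>) * (y' * word_isometry T \<nu>)"
    by (simp add: T.word_sum_ranges mult.assoc)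
  also have "\<dots> = (\<Sum>\<kappa>\<in>words_of_length n q. ((word_isometry T \<mu>)\<^sup>\<star> * y * word_isometry T \<kappa>) *
      ((word_isometry T \<kappa>)\<^sup>\<star> * y' * word_isometry T \<nu>))"
    by (simp only: sum_distrib_left sum_distrib_right mult.assoc)
  also have "\<dots> = ?e *\<^sub>C 1"
    unfolding complex_vector.scale_sum_left
    by (intro sum.cong refl) (simp add: c d mult_scaleC_left scaleC_scaleC)
  finally have 2: "(word_isometry T \<mu>)\<^sup>\<star> * (y * y') * word_isometry T \<nu> = ?e *\<^sub>C 1" .
  from 1 2 show "\<exists>c. (word_isometry S \<mu>)\<^sup>\<star> * (x * x') * word_isometry S \<nu> = c *\<^sub>C 1 \<and>
     (word_isometry T \<mu>)\<^sup>\<star> * (y * y') * word_isometry T \<nu> = c *\<^sub>C 1"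
    by blast
qed

lemma same_matrix_words:
  assumes "\<alpha> \<in> words_of_length n p" "\<beta> \<in> words_of_length n q"
  shows "same_matrix p q (word_isometry S \<alpha> * (word_isometry S \<beta>)\<^sup>\<star>) (word_isometry T \<alpha> * (word_isometry T \<beta>)\<^sup>\<star>)"
  unfolding same_matrix_def
proof (intro ballI)
  fix \<mu> \<nu> assume *: "\<mu> \<in> words_of_length n p" "\<nu> \<in> words_of_length n q"
  have "(word_isometry S \<mu>)\<^sup>\<star> * (word_isometry S \<alpha> * (word_isometry S \<beta>)\<^sup>\<star>) * word_isometry S \<nu> =
      ((word_isometry S \<mu>)\<^sup>\<star> * word_isometry S \<alpha>) * ((word_isometry S \<beta>)\<^sup>\<star> * word_isometry S \<nu>)"
    "(word_isometry T \<mu>)\<^sup>\<star> * (word_isometry T \<alpha> * (word_isometry T \<beta>)\<^sup>\<star>) * word_isometry T \<nu> =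
      ((word_isometry T \<mu>)\<^sup>\<star> * word_isometry T \<alpha>) * ((word_isometry T \<beta>)\<^sup>\<star> * word_isometry T \<nu>)"
    by (simp_all only: mult.assoc)
  thus "\<exists>c. (word_isometry S \<mu>)\<^sup>\<star> * (word_isometry S \<alpha> * (word_isometry S \<beta>)\<^sup>\<star>) * word_isometry S \<nu> = c *\<^sub>C 1 \<and>
     (word_isometry T \<mu>)\<^sup>\<star> * (word_isometry T \<alpha> * (word_isometry T \<beta>)\<^sup>\<star>) * word_isometry T \<nu> = c *\<^sub>C 1"
    using * assms
    by (intro exI[of _ "if \<mu> = \<alpha> \<and> \<nu> = \<beta> then 1 else 0"])
      (auto simp: words_of_length_iff S.word_star_mult T.word_star_mult)
qed

text \<open>One more letter on both sides tensors the matrix with the identity: the entry at \<mu>i,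
  \<nu>j is the old entry if i = j and 0 otherwise. This is the same in both families.\<close>

lemma same_matrix_Suc:
  assumes "same_matrix p q x y"
  shows "same_matrix (Suc p) (Suc q) x y"
  unfolding same_matrix_def
proof (intro ballI)
  fix \<mu>' \<nu>' assume *: "\<mu>' \<in> words_of_length n (Suc p)" "\<nu>' \<in> words_of_length n (Suc q)"
  obtain \<mu> i where \<mu>: "\<mu>' = \<mu> @ [i]" "\<mu> \<in> words_of_length n p" "i \<in> {1..n}"
    using *(1) by (rule words_of_length_Suc_snocE)
  obtain \<nu> j where \<nu>: "\<nu>' = \<nu> @ [j]" "\<nu> \<in> words_of_length n q" "j \<in> {1..n}"
    using *(2) by (rule words_of_length_Suc_snocE)
  obtain c where c: "(word_isometry S \<mu>)\<^sup>\<star> * x * word_isometry S \<nu> = c *\<^sub>C 1"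
     "(word_isometry T \<mu>)\<^sup>\<star> * y * word_isometry T \<nu> = c *\<^sub>C 1"
    using assms(1) \<mu>(2) \<nu>(2) unfolding same_matrix_def by blast
  have "(word_isometry S \<mu>')\<^sup>\<star> * x * word_isometry S \<nu>' =
      (S i)\<^sup>\<star> * ((word_isometry S \<mu>)\<^sup>\<star> * x * word_isometry S \<nu>) * S j"
    "(word_isometry T \<mu>')\<^sup>\<star> * y * word_isometry T \<nu>' =
      (T i)\<^sup>\<star> * ((word_isometry T \<mu>)\<^sup>\<star> * y * word_isometry T \<nu>) * T j"
    by (simp_all add: \<mu>(1) \<nu>(1) word_isometry_append star_mult mult.assoc)
  thus "\<exists>c. (word_isometry S \<mu>')\<^sup>\<star> * x * word_isometry S \<nu>' = c *\<^sub>C 1 \<and>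
     (word_isometry T \<mu>')\<^sup>\<star> * y * word_isometry T \<nu>' = c *\<^sub>C 1"
    unfolding c
    by (intro exI[of _ "if i = j then c else 0"])
      (simp add: mult_scaleC_left mult_scaleC_right S.generator_star_mult[OF \<mu>(3) \<nu>(3)]
        T.generator_star_mult[OF \<mu>(3) \<nu>(3)])
qed

lemma same_matrix_add_length: "same_matrix p q x y \<Longrightarrow> same_matrix (p + k) (q + k) x y"
  by (induction k) (auto intro: same_matrix_Suc)

text \<open>Each coefficient is a compression of \<open>x\<close> by word isometries, so its modulus
  is at most \<open>norm x\<close>; then count the terms. What matters is that the constant depends
  on \<open>p\<close> and \<open>q\<close> alone.\<close>

lemma same_matrix_crude_bound:
  assumes "same_matrix p q x y"
  shows "norm y \<le> real (card (words_of_length n p) * card (words_of_length n q)) * norm x"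
proof -
  have "norm y = norm (\<Sum>\<mu>\<in>words_of_length n p. \<Sum>\<nu>\<in>words_of_length n q.
      word_isometry T \<mu> * ((word_isometry T \<mu>)\<^sup>\<star> * y * word_isometry T \<nu>) * (word_isometry T \<nu>)\<^sup>\<star>)"
    by (simp flip: T.word_decomposition)
  also have "\<dots> \<le> (\<Sum>\<mu>\<in>words_of_length n p. \<Sum>\<nu>\<in>words_of_length n q. norm x)"
  proof (intro sum_norm_le)
    fix \<mu> \<nu> assume *: "\<mu> \<in> words_of_length n p" "\<nu> \<in> words_of_length n q"
    then obtain c where c: "(word_isometry S \<mu>)\<^sup>\<star> * x * word_isometry S \<nu> = c *\<^sub>C 1"
      "(word_isometry T \<mu>)\<^sup>\<star> * y * word_isometry T \<nu> = c *\<^sub>C 1"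
      using assms unfolding same_matrix_def by blast
    have words: "\<mu> \<in> words n" "\<nu> \<in> words n"
      using * by (auto simp: words_of_length_iff)
    have "norm (word_isometry T \<mu> * (c *\<^sub>C 1) * (word_isometry T \<nu>)\<^sup>\<star>) \<le> norm (c *\<^sub>C (1::'b))"
      using norm_compression_le[of "(word_isometry T \<mu>)\<^sup>\<star>" "(word_isometry T \<nu>)\<^sup>\<star>"] words
        T.norm_word_le[of \<mu>] T.norm_word_le[of \<nu>] by (metis norm_star star_star)
    also have "\<dots> = norm ((word_isometry S \<mu>)\<^sup>\<star> * x * word_isometry S \<nu>)"
      by (simp add: c)
    also have "\<dots> \<le> norm x"
      by (intro norm_compression_le S.norm_word_le words)
    finally show "norm (word_isometry T \<mu> * ((word_isometry T \<mu>)\<^sup>\<star> * y * word_isometry T \<nu>) *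
        (word_isometry T \<nu>)\<^sup>\<star>) \<le> norm x"
      by (simp add: c)
  qed
  finally show ?thesis
    by (simp add: mult.assoc)
qed

lemma same_matrix_1: "same_matrix p p 1 1"
  using same_matrix_add_length[OF same_matrix_words[of "[]" 0 "[]" 0], of p] by simp

lemma same_matrix_power: "same_matrix p p x y \<Longrightarrow> same_matrix p p (x ^ k) (y ^ k)"
  by (induction k) (auto intro: same_matrix_1 same_matrix_mult)

text \<open>All powers of \<open>a = x\<^sup>\<star> * x\<close> are matrices of the same size, so
  the crude constant stays fixed while the exponent doubles. For the self-adjoint \<open>b\<close>
  the norm of the power is the power of the norm.\<close>

lemma same_matrix_norm_le:
  assumes "same_matrix p q x y"
  shows "norm y \<le> norm x"
proof -
  define a b where "a = x\<^sup>\<star> * x" and "b = y\<^sup>\<star> * y"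
  have ab: "same_matrix q q a b"
    unfolding a_def b_def by (intro same_matrix_mult[where q = p] same_matrix_star assms)
  have "b\<^sup>\<star> = b"
    by (simp add: b_def star_mult star_star)
  define C where "C = real (card (words_of_length n q) * card (words_of_length n q))"
  have "norm b \<le> norm a"
  proof (rule le_if_power_le_linear)
    fix j
    have "norm b ^ 2 ^ j = norm (b ^ 2 ^ j)"
      using \<open>b\<^sup>\<star> = b\<close> by (simp add: norm_power_selfadjoint)
    also have "\<dots> \<le> C * norm (a ^ 2 ^ j)"
      unfolding C_def by (rule same_matrix_crude_bound[OF same_matrix_power[OF ab]])
    also have "\<dots> \<le> C * norm a ^ 2 ^ j"
      by (intro mult_left_mono norm_power_ineq) (simp add: C_def)
    \<comment> \<open>The additional \<open>2 ^ j\<close> only matches the form of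
      \<open>le_if_power_le_linear\<close>.\<close>
    also have "\<dots> \<le> C * 2 ^ j * norm a ^ 2 ^ j"
      by (intro mult_right_mono) (auto simp: C_def mult_le_cancel_left1)
    finally show "norm b ^ 2 ^ j \<le> C * 2 ^ j * norm a ^ 2 ^ j" .
  qed auto
  hence "(norm y)\<^sup>2 \<le> (norm x)\<^sup>2"
    by (simp add: a_def b_def cstar_identity)
  thus ?thesis
    by (rule power2_le_imp_le) simp
qed

lemma same_matrix_spread_compress:
  assumes "same_matrix p' q x y" "p \<le> p' + J" "p' \<le> p + J"
  shows "(S.spread J p)\<^sup>\<star> * x * S.spread J q = (if p = p' then x else 0)"
proof -
  obtain c where c: "\<And>\<mu> \<nu>. \<mu> \<in> words_of_length n p' \<Longrightarrow> \<nu> \<in> words_of_length n q \<Longrightarrow>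
      (word_isometry S \<mu>)\<^sup>\<star> * x * word_isometry S \<nu> = c \<mu> \<nu> *\<^sub>C 1"
    using same_matrix_coeffsE[OF assms(1)] by metis
  have x: "x = (\<Sum>\<mu>\<in>words_of_length n p'. \<Sum>\<nu>\<in>words_of_length n q.
      c \<mu> \<nu> *\<^sub>C (word_isometry S \<mu> * (word_isometry S \<nu>)\<^sup>\<star>))"
    using S.word_decomposition[where x = x and p = p' and q = q] by (simp add: c mult_scaleC_left mult_scaleC_right)
  have "(S.spread J p)\<^sup>\<star> * x * S.spread J q = (\<Sum>\<mu>\<in>words_of_length n p'. \<Sum>\<nu>\<in>words_of_length n q.
      c \<mu> \<nu> *\<^sub>C ((S.spread J p)\<^sup>\<star> * (word_isometry S \<mu> * (word_isometry S \<nu>)\<^sup>\<star>) * S.spread J q))"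
    by (subst x) (simp add: sum_distrib_left sum_distrib_right mult_scaleC_left mult_scaleC_right)
  also have "\<dots> = (\<Sum>\<mu>\<in>words_of_length n p'. \<Sum>\<nu>\<in>words_of_length n q.
      c \<mu> \<nu> *\<^sub>C (if p = p' then word_isometry S \<mu> * (word_isometry S \<nu>)\<^sup>\<star> else 0))"
    by (intro sum.cong refl arg_cong2[of _ _ _ _ scaleC] S.spread_compress_word assms)
  also have "\<dots> = (if p = p' then x else 0)"
    using x by simp
  finally show ?thesis .
qed


text \<open>Degree \<open>k\<close> means shape (q + k, q) for all large \<open>q\<close>: an
  element is a matrix only once the words are long enough, and large \<open>q\<close> also keep
  \<open>nat\<close> from truncating.\<close>

definition same_homogeneous :: "int \<Rightarrow> 'a \<Rightarrow> 'b \<Rightarrow> bool" where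
  "same_homogeneous k x y \<longleftrightarrow> (\<forall>\<^sub>F q in sequentially. same_matrix (nat (int q + k)) q x y)"

lemma same_homogeneous_0: "same_homogeneous k 0 0"
  by (simp add: same_homogeneous_def same_matrix_0)

lemma same_homogeneous_add:
  "same_homogeneous k x y \<Longrightarrow> same_homogeneous k x' y' \<Longrightarrow> same_homogeneous k (x + x') (y + y')"
  unfolding same_homogeneous_def by (erule (1) eventually_elim2) (rule same_matrix_add)

lemma same_homogeneous_sum:
  "(\<And>i. i \<in> I \<Longrightarrow> same_homogeneous k (f i) (g i)) \<Longrightarrow> same_homogeneous k (sum f I) (sum g I)"
  by (induction I rule: infinite_finite_induct) (auto intro: same_homogeneous_0 same_homogeneous_add)

lemma same_homogeneous_scaleC:
  "same_homogeneous k x y \<Longrightarrow> same_homogeneous k (a *\<^sub>C x) (a *\<^sub>C y)"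
  unfolding same_homogeneous_def by (elim eventually_mono) (rule same_matrix_scaleC)

lemma same_homogeneous_star:
  assumes "same_homogeneous k x y"
  shows "same_homogeneous (- k) (x\<^sup>\<star>) (y\<^sup>\<star>)"
proof -
  obtain N where N: "\<And>q. q \<ge> N \<Longrightarrow> same_matrix (nat (int q + k)) q x y"
    using assms by (auto simp: same_homogeneous_def eventually_sequentially)
  \<comment> \<open>Enlarging the threshold by \<bar>k\<bar> keeps q - k nonnegative and above
    \<open>N\<close>.\<close>
  have "same_matrix (nat (int q - k)) q (x\<^sup>\<star>) (y\<^sup>\<star>)" if "q \<ge> N + nat \<bar>k\<bar>" for q
  proof -
    have "nat (int q - k) \<ge> N" "nat (int (nat (int q - k)) + k) = q"
      using that by auto
    with same_matrix_star[OF N, of "nat (int q - k)"] show ?thesis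
      by simp
  qed
  thus ?thesis
    by (auto simp: same_homogeneous_def eventually_sequentially)
qed

lemma same_homogeneous_mult:
  assumes "same_homogeneous k x y" "same_homogeneous l x' y'"
  shows "same_homogeneous (k + l) (x * x') (y * y')"
proof -
  obtain N where N: "\<And>q. q \<ge> N \<Longrightarrow> same_matrix (nat (int q + k)) q x y"
    using assms(1) by (auto simp: same_homogeneous_def eventually_sequentially)
  obtain M where M: "\<And>q. q \<ge> M \<Longrightarrow> same_matrix (nat (int q + l)) q x' y'"
    using assms(2) by (auto simp: same_homogeneous_def eventually_sequentially)
  have "same_matrix (nat (int q + (k + l))) q (x * x') (y * y')" if "q \<ge> M + N + nat \<bar>l\<bar>" for q
  proof -
    have *: "nat (int q + l) \<ge> N" "nat (int (nat (int q + l)) + k) = nat (int q + (k + l))" "q \<ge> M"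
      using that by auto
    from same_matrix_mult[OF N[OF *(1)] M[OF *(3)]] *(2) show ?thesis
      by simp
  qed
  thus ?thesis
    by (auto simp: same_homogeneous_def eventually_sequentially)
qed

lemma same_homogeneous_words:
  assumes "\<alpha> \<in> words n" "\<beta> \<in> words n"
  shows "same_homogeneous (int (length \<alpha>) - int (length \<beta>))
    (word_isometry S \<alpha> * (word_isometry S \<beta>)\<^sup>\<star>) (word_isometry T \<alpha> * (word_isometry T \<beta>)\<^sup>\<star>)"
  unfolding same_homogeneous_def eventually_sequentially
proof (intro exI[of _ "length \<beta>"] allI impI)
  fix q assume "length \<beta> \<le> q"
  then obtain r where r: "q = length \<beta> + r"
    using le_Suc_ex by blast
  have "nat (int q + (int (length \<alpha>) - int (length \<beta>))) = length \<alpha> + r"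
    by (simp add: r)
  thus "same_matrix (nat (int q + (int (length \<alpha>) - int (length \<beta>)))) q
      (word_isometry S \<alpha> * (word_isometry S \<beta>)\<^sup>\<star>) (word_isometry T \<alpha> * (word_isometry T \<beta>)\<^sup>\<star>)"
    using same_matrix_add_length[OF same_matrix_words[of \<alpha> "length \<alpha>" \<beta> "length \<beta>"], of r] assms r
    by (simp add: words_of_length_iff)
qed

text \<open>\<open>X\<close> and \<open>Y\<close> list corresponding homogeneous components. They
  are total functions vanishing outside the range of degrees, so that products become convolutions
  with freely shifted indices.\<close>

definition same_poly :: "nat \<Rightarrow> 'a \<Rightarrow> 'b \<Rightarrow> bool" where
  "same_poly d x y \<longleftrightarrow> (\<exists>X Y. (\<forall>k. same_homogeneous k (X k) (Y k)) \<and>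
     (\<forall>k. int d < \<bar>k\<bar> \<longrightarrow> X k = 0 \<and> Y k = 0) \<and>
     x = (\<Sum>k=-int d..int d. X k) \<and> y = (\<Sum>k=-int d..int d. Y k))"

text \<open>With \<open>m = 0\<close> this enlarges the degree bound; general \<open>m\<close>
  serves the convolution in products.\<close>

lemma sum_shifted_support:
  fixes X :: "int \<Rightarrow> 'c::comm_monoid_add"
  assumes "\<And>k. int d < \<bar>k\<bar> \<Longrightarrow> X k = 0" "int d + \<bar>m\<bar> \<le> int e"
  shows "(\<Sum>k=-int e..int e. X (k - m)) = (\<Sum>k=-int d..int d. X k)"
proof -
  have "(\<Sum>k=-int e..int e. X (k - m)) = (\<Sum>k=-int e-m..int e-m. X k)"
    by (rule sum.reindex_bij_witness[of _ "\<lambda>k. k + m" "\<lambda>k. k - m"]) auto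
  also have "\<dots> = (\<Sum>k=-int d..int d. X k)"
    by (rule sum.mono_neutral_right) (use assms in auto)
  finally show ?thesis .
qed

lemma same_poly_mono:
  assumes "same_poly d x y" "d \<le> e"
  shows "same_poly e x y"
proof -
  obtain X Y where XY: "\<And>k. same_homogeneous k (X k) (Y k)"
    "\<And>k. int d < \<bar>k\<bar> \<Longrightarrow> X k = 0" "\<And>k. int d < \<bar>k\<bar> \<Longrightarrow> Y k = 0"
    "x = (\<Sum>k=-int d..int d. X k)" "y = (\<Sum>k=-int d..int d. Y k)"
    using assms(1) unfolding same_poly_def by metis
  show ?thesis
    unfolding same_poly_def
    by (intro exI[of _ X] exI[of _ Y])
      (use XY assms(2) sum_shifted_support[of d X 0 e] sum_shifted_support[of d Y 0 e] in auto)
qed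

lemma same_poly_add:
  assumes "same_poly d x y" "same_poly d x' y'"
  shows "same_poly d (x + x') (y + y')"
proof -
  obtain X Y where XY: "\<And>k. same_homogeneous k (X k) (Y k)"
    "\<And>k. int d < \<bar>k\<bar> \<Longrightarrow> X k = 0" "\<And>k. int d < \<bar>k\<bar> \<Longrightarrow> Y k = 0"
    "x = (\<Sum>k=-int d..int d. X k)" "y = (\<Sum>k=-int d..int d. Y k)"
    using assms(1) unfolding same_poly_def by metis
  obtain X' Y' where XY': "\<And>k. same_homogeneous k (X' k) (Y' k)"
    "\<And>k. int d < \<bar>k\<bar> \<Longrightarrow> X' k = 0" "\<And>k. int d < \<bar>k\<bar> \<Longrightarrow> Y' k = 0"
    "x' = (\<Sum>k=-int d..int d. X' k)" "y' = (\<Sum>k=-int d..int d. Y' k)"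
    using assms(2) unfolding same_poly_def by metis
  show ?thesis
    unfolding same_poly_def
    by (intro exI[of _ "\<lambda>k. X k + X' k"] exI[of _ "\<lambda>k. Y k + Y' k"])
      (use XY XY' in \<open>auto simp: sum.distrib intro: same_homogeneous_add\<close>)
qed

lemma same_poly_scaleC:
  assumes "same_poly d x y"
  shows "same_poly d (a *\<^sub>C x) (a *\<^sub>C y)"
proof -
  obtain X Y where XY: "\<And>k. same_homogeneous k (X k) (Y k)"
    "\<And>k. int d < \<bar>k\<bar> \<Longrightarrow> X k = 0" "\<And>k. int d < \<bar>k\<bar> \<Longrightarrow> Y k = 0"
    "x = (\<Sum>k=-int d..int d. X k)" "y = (\<Sum>k=-int d..int d. Y k)"
    using assms(1) unfolding same_poly_def by metis
  show ?thesis
    unfolding same_poly_def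
    by (intro exI[of _ "\<lambda>k. a *\<^sub>C X k"] exI[of _ "\<lambda>k. a *\<^sub>C Y k"])
      (use XY in \<open>auto simp: complex_vector.scale_sum_right intro: same_homogeneous_scaleC\<close>)
qed

lemma same_poly_star:
  assumes "same_poly d x y"
  shows "same_poly d (x\<^sup>\<star>) (y\<^sup>\<star>)"
proof -
  obtain X Y where XY: "\<And>k. same_homogeneous k (X k) (Y k)"
    "\<And>k. int d < \<bar>k\<bar> \<Longrightarrow> X k = 0" "\<And>k. int d < \<bar>k\<bar> \<Longrightarrow> Y k = 0"
    "x = (\<Sum>k=-int d..int d. X k)" "y = (\<Sum>k=-int d..int d. Y k)"
    using assms(1) unfolding same_poly_def by metis
  have "(\<Sum>k=-int d..int d. (X k)\<^sup>\<star>) = (\<Sum>k=-int d..int d. (X (-k))\<^sup>\<star>)"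
    "(\<Sum>k=-int d..int d. (Y k)\<^sup>\<star>) = (\<Sum>k=-int d..int d. (Y (-k))\<^sup>\<star>)"
    by (rule sum.reindex_bij_witness[of _ uminus uminus]; auto)+
  moreover have "same_homogeneous k ((X (-k))\<^sup>\<star>) ((Y (-k))\<^sup>\<star>)" for k
    using same_homogeneous_star[OF XY(1)[of "-k"]] by simp
  ultimately show ?thesis
    unfolding same_poly_def
    by (intro exI[of _ "\<lambda>k. (X (-k))\<^sup>\<star>"] exI[of _ "\<lambda>k. (Y (-k))\<^sup>\<star>"])
      (use XY in \<open>auto simp: star_sum\<close>)
qed

lemma same_poly_mult:
  assumes "same_poly d x y" "same_poly d' x' y'"
  shows "same_poly (d + d') (x * x') (y * y')"
proof -
  obtain X Y where XY: "\<And>k. same_homogeneous k (X k) (Y k)"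
    "\<And>k. int d < \<bar>k\<bar> \<Longrightarrow> X k = 0" "\<And>k. int d < \<bar>k\<bar> \<Longrightarrow> Y k = 0"
    "x = (\<Sum>k=-int d..int d. X k)" "y = (\<Sum>k=-int d..int d. Y k)"
    using assms(1) unfolding same_poly_def by metis
  obtain X' Y' where XY': "\<And>k. same_homogeneous k (X' k) (Y' k)"
    "\<And>k. int d' < \<bar>k\<bar> \<Longrightarrow> X' k = 0" "\<And>k. int d' < \<bar>k\<bar> \<Longrightarrow> Y' k = 0"
    "x' = (\<Sum>k=-int d'..int d'. X' k)" "y' = (\<Sum>k=-int d'..int d'. Y' k)"
    using assms(2) unfolding same_poly_def by metis
  \<comment> \<open>The degree \<open>m\<close> part of the product, as a Cauchy product of the
    components.\<close>
  define Z where "Z m = (\<Sum>k=-int d..int d. X k * X' (m - k))" for m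
  define Z' where "Z' m = (\<Sum>k=-int d..int d. Y k * Y' (m - k))" for m
  have "same_homogeneous m (Z m) (Z' m)" for m
    unfolding Z_def Z'_def
  proof (intro same_homogeneous_sum)
    fix k
    show "same_homogeneous m (X k * X' (m - k)) (Y k * Y' (m - k))"
      using same_homogeneous_mult[OF XY(1)[of k] XY'(1)[of "m - k"]] by simp
  qed
  moreover have "Z m = 0 \<and> Z' m = 0" if "int (d + d') < \<bar>m\<bar>" for m
  proof -
    have "X' (m - k) = 0" "Y' (m - k) = 0" if "k \<in> {-int d..int d}" for k
      using that \<open>int (d + d') < \<bar>m\<bar>\<close> by (intro XY'; auto)+
    thus ?thesis
      by (simp add: Z_def Z'_def)
  qed
  moreover have "x * x' = (\<Sum>m=-int (d + d')..int (d + d'). Z m)"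
  proof -
    have "(\<Sum>m=-int (d + d')..int (d + d'). Z m)
        = (\<Sum>k=-int d..int d. X k * (\<Sum>m=-int (d + d')..int (d + d'). X' (m - k)))"
      unfolding Z_def sum_distrib_left by (rule sum.swap)
    also have "\<dots> = (\<Sum>k=-int d..int d. X k * x')"
    proof (intro sum.cong refl arg_cong2[of _ _ _ _ "(*)"])
      fix k assume "k \<in> {-int d..int d}"
      thus "(\<Sum>m=-int (d + d')..int (d + d'). X' (m - k)) = x'"
        unfolding XY'(4) by (intro sum_shifted_support XY'(2)) auto
    qed
    finally show ?thesis
      by (simp add: XY(4) sum_distrib_right)
  qed
  moreover have "y * y' = (\<Sum>m=-int (d + d')..int (d + d'). Z' m)"
  proof -
    have "(\<Sum>m=-int (d + d')..int (d + d'). Z' m)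
        = (\<Sum>k=-int d..int d. Y k * (\<Sum>m=-int (d + d')..int (d + d'). Y' (m - k)))"
      unfolding Z'_def sum_distrib_left by (rule sum.swap)
    also have "\<dots> = (\<Sum>k=-int d..int d. Y k * y')"
    proof (intro sum.cong refl arg_cong2[of _ _ _ _ "(*)"])
      fix k assume "k \<in> {-int d..int d}"
      thus "(\<Sum>m=-int (d + d')..int (d + d'). Y' (m - k)) = y'"
        unfolding XY'(5) by (intro sum_shifted_support XY'(3)) auto
    qed
    finally show ?thesis
      by (simp add: XY(5) sum_distrib_right)
  qed
  ultimately show ?thesis
    unfolding same_poly_def by (intro exI[of _ Z] exI[of _ Z']) blast
qed

lemma same_poly_words:
  assumes "\<alpha> \<in> words n" "\<beta> \<in> words n"
  shows "\<exists>d. same_poly d (word_isometry S \<alpha> * (word_isometry S \<beta>)\<^sup>\<star>) (word_isometry T \<alpha> * (word_isometry T \<beta>)\<^sup>\<star>)"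
proof -
  define l where "l = int (length \<alpha>) - int (length \<beta>)"
  define x where "x = word_isometry S \<alpha> * (word_isometry S \<beta>)\<^sup>\<star>"
  define y where "y = word_isometry T \<alpha> * (word_isometry T \<beta>)\<^sup>\<star>"
  have "same_homogeneous l x y"
    using same_homogeneous_words[OF assms] by (simp add: l_def x_def y_def)
  hence "same_poly (nat \<bar>l\<bar>) x y"
    unfolding same_poly_def
    by (intro exI[of _ "\<lambda>k. if k = l then x else 0"] exI[of _ "\<lambda>k. if k = l then y else 0"])
      (auto intro: same_homogeneous_0)
  thus ?thesis
    by (auto simp: x_def y_def)
qed

lemma same_poly_1: "same_poly 0 1 1"
proof -
  have "same_homogeneous 0 1 1"
    by (simp add: same_homogeneous_def same_matrix_1)
  thus ?thesis
    unfolding same_poly_def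
    by (intro exI[of _ "\<lambda>k. if k = 0 then 1 else 0"]) (auto intro: same_homogeneous_0)
qed

lemma same_poly_power: "same_poly d x y \<Longrightarrow> same_poly (d * m) (x ^ m) (y ^ m)"
  by (induction m) (auto intro: same_poly_1 same_poly_mult)

text \<open>Compression by two spread isometries isolates a single component, so
  \<open>norm (X k) \<le> norm x\<close>. Each \<open>Y k\<close> is bounded by \<open>X k\<close>,
  and there are 2d + 1 of them.\<close>

lemma same_poly_linear_bound:
  assumes "same_poly d x y"
  shows "norm y \<le> (2 * real d + 1) * norm x"
proof -
  obtain X Y where XY: "\<And>k. same_homogeneous k (X k) (Y k)"
    "x = (\<Sum>k=-int d..int d. X k)" "y = (\<Sum>k=-int d..int d. Y k)"
    using assms(1) unfolding same_poly_def by metis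
  have "\<forall>\<^sub>F q in sequentially. \<forall>k\<in>{-int d..int d}. same_matrix (nat (int q + k)) q (X k) (Y k)"
    using XY(1) by (intro eventually_ball_finite) (auto simp: same_homogeneous_def)
  then obtain N where N: "\<And>q k. q \<ge> N \<Longrightarrow> k \<in> {-int d..int d} \<Longrightarrow> same_matrix (nat (int q + k)) q (X k) (Y k)"
    unfolding eventually_sequentially by blast
  \<comment> \<open>Adding \<open>d\<close> makes q + k nonnegative for all occurring degrees, so
    \<open>nat\<close> keeps different degrees apart.\<close>
  define q where "q = N + d"
  have M: "same_matrix (nat (int q + k)) q (X k) (Y k)" if "k \<in> {-int d..int d}" for k
    by (rule N[OF _ that]) (simp add: q_def)
  have le: "norm (X k) \<le> norm x" if k: "k \<in> {-int d..int d}" for k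
  proof -
    let ?p = "nat (int q + k)"
    \<comment> \<open>Two degrees between -d and d differ by at most 2d, hence the probe
      length.\<close>
    let ?v = "S.spread (2 * d) ?p" and ?w = "S.spread (2 * d) q"
    have "?v\<^sup>\<star> * x * ?w = (\<Sum>l=-int d..int d. ?v\<^sup>\<star> * X l * ?w)"
      by (simp add: XY(2) sum_distrib_left sum_distrib_right)
    also have "\<dots> = (\<Sum>l=-int d..int d. if l = k then X l else 0)"
    proof (intro sum.cong refl)
      fix l assume l: "l \<in> {-int d..int d}"
      have "?v\<^sup>\<star> * X l * ?w = (if ?p = nat (int q + l) then X l else 0)"
        by (rule same_matrix_spread_compress[OF M[OF l]]) (use k l in \<open>auto simp: q_def\<close>)
      also have "?p = nat (int q + l) \<longleftrightarrow> l = k"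
        using k l by (auto simp: q_def)
      finally show "?v\<^sup>\<star> * X l * ?w = (if l = k then X l else 0)" .
    qed
    also have "\<dots> = X k"
      using k by simp
    finally have "X k = ?v\<^sup>\<star> * x * ?w" ..
    moreover have "norm ?v \<le> 1" "norm ?w \<le> 1"
      by (simp_all add: norm_isometry S.spread_isometry)
    ultimately show ?thesis
      using norm_compression_le[of ?v ?w x] by simp
  qed
  have "norm y \<le> (\<Sum>k=-int d..int d. norm x)"
    unfolding XY(3) using le same_matrix_norm_le[OF M] by (intro sum_norm_le) (meson order.trans)
  thus ?thesis
    by (simp add: algebra_simps)
qed

text \<open>Powers of a self-adjoint element turn the linear growth in the degree into contractivity.\<close>

lemma same_poly_norm_le:
  assumes "same_poly d x y"
  shows "norm y \<le> norm x"
proof -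
  define a b where "a = x\<^sup>\<star> * x" and "b = y\<^sup>\<star> * y"
  have ab: "same_poly (d + d) a b"
    unfolding a_def b_def by (intro same_poly_mult same_poly_star assms)
  have "b\<^sup>\<star> = b"
    by (simp add: b_def star_mult star_star)
  have "norm b \<le> norm a"
  proof (rule le_if_power_le_linear)
    fix j
    have "norm b ^ 2 ^ j = norm (b ^ 2 ^ j)"
      using \<open>b\<^sup>\<star> = b\<close> by (simp add: norm_power_selfadjoint)
    also have "\<dots> \<le> (2 * real ((d + d) * 2 ^ j) + 1) * norm (a ^ 2 ^ j)"
      by (rule same_poly_linear_bound[OF same_poly_power[OF ab]])
    also have "\<dots> \<le> ((4 * real d + 1) * 2 ^ j) * norm a ^ 2 ^ j"
      by (intro mult_mono norm_power_ineq) (auto simp: algebra_simps)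
    finally show "norm b ^ 2 ^ j \<le> (4 * real d + 1) * 2 ^ j * norm a ^ 2 ^ j" .
  qed auto
  hence "(norm y)\<^sup>2 \<le> (norm x)\<^sup>2"
    by (simp add: a_def b_def cstar_identity)
  thus ?thesis
    by (rule power2_le_imp_le) simp
qed

end

section \<open>Word polynomials and the universal homomorphism\<close>

lemma cstar_subalgebra_closure:
  fixes B :: "'a::unital_cstar_algebra set"
  assumes B: "complex_vector.subspace B" "\<And>x y. x \<in> B \<Longrightarrow> y \<in> B \<Longrightarrow> x * y \<in> B"
    "\<And>x. x \<in> B \<Longrightarrow> x\<^sup>\<star> \<in> B"
  shows "cstar_subalgebra (closure B)"
proof -
  have approx: "\<exists>X. (\<forall>k. X k \<in> B) \<and> X \<longlonglongrightarrow> x" if "x \<in> closure B" for x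
    using that by (simp add: closure_sequential)
  have lim: "x \<in> closure B" if "\<And>k. X k \<in> B" "X \<longlonglongrightarrow> x" for X :: "nat \<Rightarrow> 'a" and x
    using that by (auto simp: closure_sequential)
  have "complex_vector.subspace (closure B)"
    unfolding complex_vector.subspace_def
  proof (intro conjI ballI allI)
    show "0 \<in> closure B"
      using complex_vector.subspace_0[OF B(1)] closure_subset by blast
    fix x assume "x \<in> closure B"
    then obtain X where X: "\<And>k. X k \<in> B" "X \<longlonglongrightarrow> x"
      using approx by blast
    show "c *\<^sub>C x \<in> closure B" for c
      by (rule lim[of "\<lambda>k. c *\<^sub>C X k"]) (use X B in \<open>auto intro: complex_vector.subspace_scale tendsto_intros\<close>)
    fix y assume "y \<in> closure B"
    then obtain Y where Y: "\<And>k. Y k \<in> B" "Y \<longlonglongrightarrow> y"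
      using approx by blast
    show "x + y \<in> closure B"
      by (rule lim[of "\<lambda>k. X k + Y k"]) (use X Y B in \<open>auto intro: complex_vector.subspace_add tendsto_intros\<close>)
  qed
  moreover have "x * y \<in> closure B" if xy: "x \<in> closure B" "y \<in> closure B" for x y
  proof -
    obtain X Y where XY: "\<And>k. X k \<in> B" "X \<longlonglongrightarrow> x" "\<And>k. Y k \<in> B" "Y \<longlonglongrightarrow> y"
      using approx xy by metis
    show ?thesis
      by (rule lim[of "\<lambda>k. X k * Y k"]) (use XY B in \<open>auto intro: tendsto_intros\<close>)
  qed
  moreover have "x\<^sup>\<star> \<in> closure B" if x: "x \<in> closure B" for x
  proof -
    obtain X where X: "\<And>k. X k \<in> B" "X \<longlonglongrightarrow> x"
      using approx x by metis
    show ?thesis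
      by (rule lim[of "\<lambda>k. (X k)\<^sup>\<star>"]) (use X B in \<open>auto intro: tendsto_intros\<close>)
  qed
  ultimately show ?thesis
    by (simp add: cstar_subalgebra_def)
qed

context cuntz_family
begin

definition word_polys :: "'a set" where
  "word_polys = complex_vector.span
     {word_isometry S \<alpha> * (word_isometry S \<beta>)\<^sup>\<star> | \<alpha> \<beta>. \<alpha> \<in> words n \<and> \<beta> \<in> words n}"

lemma word_polys_subspace: "complex_vector.subspace word_polys"
  by (simp add: word_polys_def)

lemma word_polys_words:
  "\<alpha> \<in> words n \<Longrightarrow> \<beta> \<in> words n \<Longrightarrow> word_isometry S \<alpha> * (word_isometry S \<beta>)\<^sup>\<star> \<in> word_polys"
  unfolding word_polys_def by (intro complex_vector.span_base) blast

lemma word_polys_induct [consumes 1, case_names word zero add scale]: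
  assumes "x \<in> word_polys"
    and "\<And>\<alpha> \<beta>. \<alpha> \<in> words n \<Longrightarrow> \<beta> \<in> words n \<Longrightarrow> P (word_isometry S \<alpha> * (word_isometry S \<beta>)\<^sup>\<star>)"
    and "P 0" "\<And>x y. P x \<Longrightarrow> P y \<Longrightarrow> P (x + y)" "\<And>c x. P x \<Longrightarrow> P (c *\<^sub>C x)"
  shows "P x"
  using assms(1) unfolding word_polys_def
  by (rule complex_vector.span_induct) (use assms(2-) in \<open>auto simp: complex_vector.subspace_def\<close>)

lemma word_polys_star: "x \<in> word_polys \<Longrightarrow> x\<^sup>\<star> \<in> word_polys"
proof (induction rule: word_polys_induct)
  case (word \<alpha> \<beta>)
  thus ?case
    using word_polys_words[of \<beta> \<alpha>] by (simp add: star_mult star_star)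
qed (use word_polys_subspace in \<open>auto simp: star_add star_scaleC complex_vector.subspace_def\<close>)

lemma word_polys_mult_words:
  assumes "\<alpha> \<in> words n" "\<beta> \<in> words n" "\<gamma> \<in> words n" "\<delta> \<in> words n"
  shows "(word_isometry S \<alpha> * (word_isometry S \<beta>)\<^sup>\<star>) * (word_isometry S \<gamma> * (word_isometry S \<delta>)\<^sup>\<star>) \<in> word_polys"
proof -
  have eq: "(word_isometry S \<alpha> * (word_isometry S \<beta>)\<^sup>\<star>) * (word_isometry S \<gamma> * (word_isometry S \<delta>)\<^sup>\<star>)
      = word_isometry S \<alpha> * ((word_isometry S \<beta>)\<^sup>\<star> * word_isometry S \<gamma>) * (word_isometry S \<delta>)\<^sup>\<star>"
    by (simp only: mult.assoc)
  show ?thesis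
  proof (cases rule: word_star_mult_cases[OF assms(2,3)])
    case 1
    thus ?thesis
      unfolding eq using complex_vector.subspace_0[OF word_polys_subspace] by simp
  next
    case (2 \<epsilon>)
    thus ?thesis
      unfolding eq using word_polys_words[of "\<alpha> @ \<epsilon>" \<delta>] assms by (simp add: word_isometry_append)
  next
    case (3 \<epsilon>)
    thus ?thesis
      unfolding eq using word_polys_words[of \<alpha> "\<delta> @ \<epsilon>"] assms
      by (simp add: word_isometry_append star_mult mult.assoc)
  qed
qed

lemma word_polys_mult:
  assumes "x \<in> word_polys" "y \<in> word_polys"
  shows "x * y \<in> word_polys"
  using assms(1)
proof (induction rule: word_polys_induct)
  case (word \<alpha> \<beta>)
  show ?case
    using assms(2)
    by (induction rule: word_polys_induct)
      (use word word_polys_mult_words word_polys_subspace in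
        \<open>auto simp: distrib_left mult_scaleC_right complex_vector.subspace_def\<close>)
qed (use word_polys_subspace in \<open>auto simp: distrib_right mult_scaleC_left complex_vector.subspace_def\<close>)

lemma word_polys_1: "1 \<in> word_polys"
  using word_polys_words[of "[]" "[]"] by simp

lemma word_polys_generator: "i \<in> {1..n} \<Longrightarrow> S i \<in> word_polys"
  using word_polys_words[of "[i]" "[]"] by simp

end

lemma unital_star_hom_word:
  assumes "unital_star_hom f" "unital_star_hom g" "\<And>i. i \<in> {1..n} \<Longrightarrow> f (S i) = g (S i)" "\<mu> \<in> words n"
  shows "f (word_isometry S \<mu>) = g (word_isometry S \<mu>)"
  using assms(4) by (induction \<mu>) (use assms(1-3) in \<open>auto simp: unital_star_hom_def\<close>)

text \<open>Nothing is assumed about continuity, so agreement extends to the polynomials only.\<close>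

lemma (in cuntz_family) unital_star_hom_eq_on_word_polys:
  assumes f: "unital_star_hom f" and g: "unital_star_hom g"
    and gens: "\<And>i. i \<in> {1..n} \<Longrightarrow> f (S i) = g (S i)" and "x \<in> word_polys"
  shows "f x = g x"
  using assms(4)
proof (induction rule: word_polys_induct)
  case (word \<alpha> \<beta>)
  hence "f (word_isometry S \<alpha>) = g (word_isometry S \<alpha>)" "f (word_isometry S \<beta>) = g (word_isometry S \<beta>)"
    using unital_star_hom_word[where S = S, OF f g gens] by blast+
  thus ?case
    using f g by (simp add: unital_star_hom_def)
next
  case zero
  show ?case
    using f g by (metis add_cancel_left_left unital_star_hom_def)
qed (use f g in \<open>auto simp: unital_star_hom_def\<close>)

locale generating_cuntz_family = cuntz_family +
  assumes generating: "cstar_subalgebra hull (S ` {1..n}) = UNIV"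
begin

lemma closure_word_polys: "closure word_polys = UNIV"
proof -
  have "cstar_subalgebra (closure word_polys)"
    by (intro cstar_subalgebra_closure word_polys_subspace word_polys_mult word_polys_star)
  moreover have "S ` {1..n} \<subseteq> closure word_polys"
    using word_polys_generator closure_subset by blast
  ultimately show ?thesis
    using hull_minimal[of "S ` {1..n}" "closure word_polys" cstar_subalgebra] generating by auto
qed

lemma word_polys_approx:
  assumes "0 < \<epsilon>"
  obtains y where "y \<in> word_polys" "norm (x - y) < \<epsilon>"
proof -
  have "x \<in> closure word_polys"
    by (simp add: closure_word_polys)
  then obtain y where "y \<in> word_polys" "dist y x < \<epsilon>"
    using assms unfolding closure_approachable by blast
  thus thesis
    using that by (simp add: dist_norm norm_minus_commute)
qed

end

text \<open>The relation \<open>G\<close> is a linear, multiplicative and star-preserving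
  correspondence between polynomials in \<open>S\<close> and in \<open>T\<close>. Applied to
  differences, the norm comparison makes it single-valued and 1-Lipschitz, so it extends to the
  closure, which is everything.\<close>

lemma (in generating_cuntz_family) universal_hom:
  fixes T :: "nat \<Rightarrow> 'b::unital_cstar_algebra"
  assumes "cuntz_family n T"
  obtains f :: "'a \<Rightarrow> 'b" where "unital_star_hom f" "\<And>i. i \<in> {1..n} \<Longrightarrow> f (S i) = T i"
    "\<And>x. norm (f x) \<le> norm x"
proof -
  interpret T: cuntz_family n T by fact
  interpret cuntz_family_pair n S T ..
  define G where "G x y \<longleftrightarrow> (\<exists>d. same_poly d x y)" for x y
  have add: "G (x + x') (y + y')" if "G x y" "G x' y'" for x y x' y'
  proof -
    from that obtain d d' where "same_poly d x y" "same_poly d' x' y'"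
      by (auto simp: G_def)
    hence "same_poly (max d d') x y" "same_poly (max d d') x' y'"
      by (auto elim: same_poly_mono)
    thus ?thesis
      using same_poly_add unfolding G_def by blast
  qed
  have scale: "G (c *\<^sub>C x) (c *\<^sub>C y)" if "G x y" for c x y
    using that same_poly_scaleC unfolding G_def by blast
  have mult: "G (x * x') (y * y')" if "G x y" "G x' y'" for x y x' y'
    using that same_poly_mult unfolding G_def by blast
  have star: "G (x\<^sup>\<star>) (y\<^sup>\<star>)" if "G x y" for x y
    using that same_poly_star unfolding G_def by blast
  have norm_le: "norm y \<le> norm x" if "G x y" for x y
    using that same_poly_norm_le by (auto simp: G_def)
  have G1: "G 1 1"
    using same_poly_1 by (auto simp: G_def)
  have words: "G (word_isometry S \<alpha> * (word_isometry S \<beta>)\<^sup>\<star>) (word_isometry T \<alpha> * (word_isometry T \<beta>)\<^sup>\<star>)"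
    if "\<alpha> \<in> words n" "\<beta> \<in> words n" for \<alpha> \<beta>
    using same_poly_words[OF that] by (simp add: G_def)
  have dist_le: "dist y y' \<le> dist x x'" if "G x y" "G x' y'" for x y x' y'
    using norm_le[OF add[OF that(1) scale[OF that(2), of "-1"]]]
    by (simp add: dist_norm)
  have uniq: "y = y'" if "G x y" "G x y'" for x y y'
    using dist_le[OF that] by simp
  define D where "D = {x. \<exists>y. G x y}"
  define f0 where "f0 x = (SOME y. G x y)" for x
  have f0: "G x (f0 x)" if "x \<in> D" for x
    unfolding f0_def by (rule someI_ex) (use that in \<open>simp add: D_def\<close>)
  have "word_polys \<subseteq> D"
  proof
    fix x assume "x \<in> word_polys"
    thus "x \<in> D"
      by (induction rule: word_polys_induct)
        (use words add scale scale[OF G1, of 0] in \<open>auto simp: D_def, blast+\<close>)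
  qed
  hence closure: "closure D = UNIV"
    using closure_mono[of word_polys D] closure_word_polys by auto
  have "uniformly_continuous_on D f0"
    unfolding uniformly_continuous_on_def
    using dist_le f0 by (meson order.strict_trans1)
  then obtain f where f: "uniformly_continuous_on (closure D) f" "\<And>x. x \<in> D \<Longrightarrow> f0 x = f x"
    by (rule uniformly_continuous_on_extension_on_closure) blast
  have cont: "continuous_on UNIV f"
    using uniformly_continuous_imp_continuous[OF f(1)] by (simp add: closure)
  have f_eq: "f x = y" if "G x y" for x y
    using that f0[of x] f(2)[of x] uniq by (auto simp: D_def)
  \<comment> \<open>With \<open>approx\<close> below, this transports every algebraic law of
    \<open>G\<close> to the extension \<open>f\<close> by passing to limits of sequences.\<close>
  have lim: "f x = y" if "\<And>k. G (X k) (Y k)" "X \<longlonglongrightarrow> x" "Y \<longlonglongrightarrow> y" for X Y x y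
  proof -
    have "(\<lambda>k. f (X k)) \<longlonglongrightarrow> f x"
      using cont that(2) by (auto simp: continuous_on_sequentially o_def)
    moreover have "(\<lambda>k. f (X k)) = Y"
      using f_eq[OF that(1)] by auto
    ultimately show ?thesis
      using that(3) LIMSEQ_unique by blast
  qed
  have approx: "\<exists>X Y. (\<forall>k. G (X k) (Y k)) \<and> X \<longlonglongrightarrow> x \<and> Y \<longlonglongrightarrow> f x" for x
  proof -
    have "x \<in> closure D"
      by (simp add: closure)
    then obtain X where X: "\<And>k. X k \<in> D" "X \<longlonglongrightarrow> x"
      by (auto simp: closure_sequential)
    have "(\<lambda>k. f (X k)) \<longlonglongrightarrow> f x"
      using cont X(2) by (auto simp: continuous_on_sequentially o_def)
    moreover have "G (X k) (f (X k))" for k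
      using f0[OF X(1)] f(2)[OF X(1)] by simp
    ultimately show ?thesis
      using X(2) by (intro exI[of _ X] exI[of _ "\<lambda>k. f (X k)"]) auto
  qed
  show thesis
  proof
    show "unital_star_hom f"
      unfolding unital_star_hom_def
    proof (intro conjI allI)
      fix x y c
      obtain X X' where X: "\<And>k. G (X k) (X' k)" "X \<longlonglongrightarrow> x" "X' \<longlonglongrightarrow> f x"
        using approx by metis
      obtain Y Y' where Y: "\<And>k. G (Y k) (Y' k)" "Y \<longlonglongrightarrow> y" "Y' \<longlonglongrightarrow> f y"
        using approx by metis
      show "f (x + y) = f x + f y"
        by (rule lim[where X = "\<lambda>k. X k + Y k" and Y = "\<lambda>k. X' k + Y' k"]) (intro add tendsto_intros X Y)+
      show "f (x * y) = f x * f y"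
        by (rule lim[where X = "\<lambda>k. X k * Y k" and Y = "\<lambda>k. X' k * Y' k"]) (intro mult tendsto_intros X Y)+
      show "f (c *\<^sub>C x) = c *\<^sub>C f x"
        by (rule lim[where X = "\<lambda>k. c *\<^sub>C X k" and Y = "\<lambda>k. c *\<^sub>C X' k"]) (intro scale tendsto_intros X)+
      show "f (x\<^sup>\<star>) = (f x)\<^sup>\<star>"
        by (rule lim[where X = "\<lambda>k. (X k)\<^sup>\<star>" and Y = "\<lambda>k. (X' k)\<^sup>\<star>"]) (intro star tendsto_intros X)+
      show "f 1 = 1"
        by (rule f_eq[OF G1])
    qed
    show "f (S i) = T i" if "i \<in> {1..n}" for i
      using f_eq[OF words[of "[i]" "[]"]] that by simp
    show "norm (f x) \<le> norm x" for x
    proof -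
      obtain X X' where X: "\<And>k. G (X k) (X' k)" "X \<longlonglongrightarrow> x" "X' \<longlonglongrightarrow> f x"
        using approx by metis
      show ?thesis
        by (rule LIMSEQ_le[OF tendsto_norm[OF X(3)] tendsto_norm[OF X(2)]]) (use norm_le X(1) in auto)
    qed
  qed
qed

declare One_nat_def [simp del]

section \<open>Compression by powers of the first generator\<close>

lemma closed_scalars: "closed (range (\<lambda>c. c *\<^sub>C (1::'a::unital_cstar_algebra)))"
proof -
  have "bounded_linear (\<lambda>c. c *\<^sub>C (1::'a))"
    by (rule bounded_linear_intro[where K = 1])
      (auto simp: scaleC_add_left scaleR_eq_scaleC scaleC_scaleC scaleR_conv_of_real)
  hence "complete (range (\<lambda>c. c *\<^sub>C (1::'a)))"
    by (intro complete_isometric_image[of 1]) (auto simp: complete_UNIV)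
  thus ?thesis
    by (rule complete_imp_closed)
qed

lemma norm_isometry_mult:
  fixes v :: "'a::unital_cstar_algebra"
  assumes "v\<^sup>\<star> * v = 1"
  shows "norm (v * x) = norm x"
proof -
  have "(v * x)\<^sup>\<star> * (v * x) = x\<^sup>\<star> * (v\<^sup>\<star> * v) * x"
    by (simp add: star_mult mult.assoc)
  hence "(norm (v * x))\<^sup>2 = (norm x)\<^sup>2"
    using cstar_identity[of "v * x"] cstar_identity[of x] assms by simp
  thus ?thesis
    by simp
qed

context cuntz_family
begin

lemma one_le_n [simp]: "1 \<le> n" "n \<noteq> 1" "1 \<noteq> n"
  using n_ge_2 by auto

lemma S1_isometry [simp]: "(S 1)\<^sup>\<star> * S 1 = 1" "(S 1)\<^sup>\<star> * (S 1 * x) = x"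
  and Sn_isometry [simp]: "(S n)\<^sup>\<star> * S n = 1" "(S n)\<^sup>\<star> * (S n * x) = x"
  and S1_Sn [simp]: "(S 1)\<^sup>\<star> * S n = 0" "(S 1)\<^sup>\<star> * (S n * x) = 0"
  and Sn_S1 [simp]: "(S n)\<^sup>\<star> * S 1 = 0" "(S n)\<^sup>\<star> * (S 1 * x) = 0"
  by (simp_all add: generator_star_mult generator_star_mult_assoc)

lemma S1_power_isometry: "(S 1 ^ k)\<^sup>\<star> * S 1 ^ k = 1"
  using star_power_mult_power[of 1 k k] by (simp add: star_power)

lemma compress_power_add:
  "(S 1)\<^sup>\<star> ^ (2 * Suc k) * y * S 1 ^ (2 * Suc k)
    = (S 1)\<^sup>\<star> ^ 2 * ((S 1)\<^sup>\<star> ^ (2 * k) * y * S 1 ^ (2 * k)) * S 1 ^ 2"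
proof -
  have "(S 1)\<^sup>\<star> ^ (2 * Suc k) = (S 1)\<^sup>\<star> ^ 2 * (S 1)\<^sup>\<star> ^ (2 * k)"
    by (simp only: mult_Suc_right power_add)
  moreover have "S 1 ^ (2 * Suc k) = S 1 ^ (2 * k) * S 1 ^ 2"
    by (simp only: mult_Suc_right add.commute[of 2] power_add)
  ultimately show ?thesis
    by (simp only: mult.assoc)
qed

text \<open>The middle product is a power of \<open>S 1\<close> or the adjoint of one. In a
  nontrivial power, a letter 1 meets \<open>(S n)\<^sup>\<star>\<close> and the compression
  vanishes; so this compression reduces powers of \<open>S 1\<close> to scalars.\<close>

lemma S1n1_compress_power:
  "(S 1 * S n * S 1)\<^sup>\<star> * ((S 1)\<^sup>\<star> ^ j * S 1 ^ k) * (S 1 * S n * S 1) =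
    (if j = k then 1 else 0)"
proof -
  have *: "(S 1 * S n * S 1)\<^sup>\<star> * S 1 ^ m * (S 1 * S n * S 1) = (if m = 0 then 1 else 0)" for m
  proof (cases m)
    case (Suc l)
    have "(S 1 * S n * S 1)\<^sup>\<star> * S 1 ^ m * (S 1 * S n * S 1) =
        (S 1)\<^sup>\<star> * ((S n)\<^sup>\<star> * (S 1 ^ l * S 1)) * (S n * S 1)"
      by (simp add: Suc star_mult mult.assoc)
    also have "S 1 ^ l * S 1 = S 1 * S 1 ^ l"
      by (rule power_commutes)
    finally show ?thesis
      by (simp add: Suc)
  qed (simp add: star_mult mult.assoc)
  show ?thesis
  proof (cases "k \<le> j")
    case True
    hence "(S 1)\<^sup>\<star> ^ j * S 1 ^ k = (S 1 ^ (j - k))\<^sup>\<star>"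
      by (simp add: star_power_mult_power star_power)
    thus ?thesis
      using arg_cong[OF *[of "j - k"], of star] True
      by (auto simp: star_mult star_star mult.assoc)
  next
    case False
    hence "(S 1)\<^sup>\<star> ^ j * S 1 ^ k = S 1 ^ (k - j)"
      by (simp add: star_power_mult_power)
    thus ?thesis
      using *[of "k - j"] False by auto
  qed
qed

text \<open>For large \<open>k\<close> the compression kills a word unless \<alpha> and \<beta>
  consist of 1s only. In that case what remains is a fixed power of \<open>S 1\<close> or of its
  adjoint, which \<open>S1n1_compress_power\<close> turns into a scalar.\<close>

lemma word_polys_stabilise:
  assumes "x \<in> word_polys"
  shows "\<exists>N t c. (\<forall>k\<ge>N. (S 1)\<^sup>\<star> ^ k * x * S 1 ^ k = t) \<and>
    (S 1 * S n * S 1)\<^sup>\<star> * t * (S 1 * S n * S 1) = c *\<^sub>C 1"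
  using assms
proof (induction rule: word_polys_induct)
  case (word \<alpha> \<beta>)
  define a b where "a = length \<alpha>" and "b = length \<beta>"
  \<comment> \<open>Truncated subtraction: at most one of the two factors is a nontrivial
    power.\<close>
  define t where "t = (if \<alpha> = replicate a 1 \<and> \<beta> = replicate b 1 then (S 1)\<^sup>\<star> ^ (b - a) * S 1 ^ (a - b) else 0)"
  have "(S 1)\<^sup>\<star> ^ k * (word_isometry S \<alpha> * (word_isometry S \<beta>)\<^sup>\<star>) * S 1 ^ k = t" if k: "k \<ge> max a b" for k
  proof -
    have "(S 1)\<^sup>\<star> ^ k * (word_isometry S \<alpha> * (word_isometry S \<beta>)\<^sup>\<star>) * S 1 ^ k =
        ((S 1)\<^sup>\<star> ^ k * word_isometry S \<alpha>) * ((S 1)\<^sup>\<star> ^ k * word_isometry S \<beta>)\<^sup>\<star>"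
      by (simp add: star_mult star_power star_star mult.assoc)
    also have "\<dots> = (if \<alpha> = replicate a 1 \<and> \<beta> = replicate b 1 then (S 1)\<^sup>\<star> ^ (k - a) * S 1 ^ (k - b) else 0)"
      using word k word_star_replicate[of \<alpha> 1 k] word_star_replicate[of \<beta> 1 k]
      by (auto simp: a_def b_def star_power star_star)
    also have "\<dots> = t"
      using k by (auto simp: t_def star_power_mult_power)
    finally show ?thesis .
  qed
  moreover have "\<exists>c. (S 1 * S n * S 1)\<^sup>\<star> * t * (S 1 * S n * S 1) = c *\<^sub>C 1"
    unfolding t_def S1n1_compress_power if_distrib[of "\<lambda>t. (S 1 * S n * S 1)\<^sup>\<star> * t * (S 1 * S n * S 1)"]
    by (intro exI[of _ "if \<alpha> = replicate a 1 \<and> \<beta> = replicate b 1 \<and> b - a = a - b then 1 else 0"]) simp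
  ultimately show ?case
    by blast
next
  case zero
  show ?case
    by (intro exI[of _ 0]) auto
next
  case (add x y)
  then obtain N t c M s d where
    "\<And>k. k \<ge> N \<Longrightarrow> (S 1)\<^sup>\<star> ^ k * x * S 1 ^ k = t" "(S 1 * S n * S 1)\<^sup>\<star> * t * (S 1 * S n * S 1) = c *\<^sub>C 1"
    "\<And>k. k \<ge> M \<Longrightarrow> (S 1)\<^sup>\<star> ^ k * y * S 1 ^ k = s" "(S 1 * S n * S 1)\<^sup>\<star> * s * (S 1 * S n * S 1) = d *\<^sub>C 1"
    by metis
  thus ?case
    by (intro exI[of _ "max N M"] exI[of _ "t + s"] exI[of _ "c + d"])
      (simp add: distrib_left distrib_right scaleC_add_left)
next
  case (scale a x)
  then obtain N t c where
    "\<And>k. k \<ge> N \<Longrightarrow> (S 1)\<^sup>\<star> ^ k * x * S 1 ^ k = t" "(S 1 * S n * S 1)\<^sup>\<star> * t * (S 1 * S n * S 1) = c *\<^sub>C 1"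
    by metis
  thus ?case
    by (intro exI[of _ N] exI[of _ "a *\<^sub>C t"] exI[of _ "a * c"])
      (simp add: mult_scaleC_left mult_scaleC_right scaleC_scaleC)
qed

end

context generating_cuntz_family
begin

lemma compress_stabilise:
  assumes "0 < \<epsilon>"
  obtains N t c where "\<And>k. k \<ge> N \<Longrightarrow> norm ((S 1)\<^sup>\<star> ^ k * x * S 1 ^ k - t) < \<epsilon>"
    "(S 1 * S n * S 1)\<^sup>\<star> * t * (S 1 * S n * S 1) = c *\<^sub>C 1"
proof -
  obtain y where y: "y \<in> word_polys" "norm (x - y) < \<epsilon>"
    using assms by (rule word_polys_approx)
  obtain N t c where t: "\<And>k. k \<ge> N \<Longrightarrow> (S 1)\<^sup>\<star> ^ k * y * S 1 ^ k = t"
    "(S 1 * S n * S 1)\<^sup>\<star> * t * (S 1 * S n * S 1) = c *\<^sub>C 1"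
    using word_polys_stabilise[OF y(1)] by metis
  show thesis
  proof
    fix k assume "k \<ge> N"
    hence "(S 1)\<^sup>\<star> ^ k * x * S 1 ^ k - t = (S 1 ^ k)\<^sup>\<star> * (x - y) * S 1 ^ k"
      by (simp add: t(1)[symmetric] star_power right_diff_distrib left_diff_distrib)
    also have "norm \<dots> \<le> norm (x - y)"
      by (intro norm_compression_le) (simp_all add: norm_isometry[OF S1_power_isometry])
    finally show "norm ((S 1)\<^sup>\<star> ^ k * x * S 1 ^ k - t) < \<epsilon>"
      using y(2) by simp
  qed fact
qed

text \<open>Compressing by a high even power of \<open>S 1\<close> and then by
  \<open>S 1 * S n * S 1\<close> leaves \<open>y\<close> fixed but makes a polynomial close to
  \<open>y\<close> scalar. So \<open>y\<close> is a limit of scalars, and these form a closed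
  set.\<close>

lemma scalar_if_compressions_fix:
  assumes "(S 1)\<^sup>\<star> ^ 2 * y * S 1 ^ 2 = y" "(S 1 * S n * S 1)\<^sup>\<star> * y * (S 1 * S n * S 1) = y"
  shows "\<exists>c. y = c *\<^sub>C 1"
proof -
  let ?V = "S 1 * S n * S 1"
  have fix_even: "(S 1)\<^sup>\<star> ^ (2 * k) * y * S 1 ^ (2 * k) = y" for k
  proof (induction k)
    case (Suc k)
    have "(S 1)\<^sup>\<star> ^ (2 * Suc k) * y * S 1 ^ (2 * Suc k)
        = (S 1)\<^sup>\<star> ^ 2 * ((S 1)\<^sup>\<star> ^ (2 * k) * y * S 1 ^ (2 * k)) * S 1 ^ 2"
      by (rule compress_power_add)
    thus ?case
      using Suc assms(1) by simp
  qed simp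
  have V: "norm ?V \<le> 1"
    by (simp add: norm_isometry star_mult mult.assoc)
  have "y \<in> closure (range (\<lambda>c. c *\<^sub>C 1))"
    unfolding closure_approachable
  proof (intro allI impI)
    fix \<epsilon> :: real assume "0 < \<epsilon>"
    obtain N t c where t: "\<And>k. k \<ge> N \<Longrightarrow> norm ((S 1)\<^sup>\<star> ^ k * y * S 1 ^ k - t) < \<epsilon>"
      "?V\<^sup>\<star> * t * ?V = c *\<^sub>C 1"
      using compress_stabilise[OF \<open>0 < \<epsilon>\<close>, of y] by blast
    have "y - c *\<^sub>C 1 = ?V\<^sup>\<star> * (y - t) * ?V"
      using assms(2) t(2) by (simp add: right_diff_distrib left_diff_distrib)
    also have "norm \<dots> \<le> norm (y - t)"
      by (intro norm_compression_le V)
    also have "\<dots> < \<epsilon>"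
      using t(1)[of "2 * N"] fix_even[of N] by simp
    finally show "\<exists>s\<in>range (\<lambda>c. c *\<^sub>C 1). dist s y < \<epsilon>"
      by (auto simp: dist_norm norm_minus_commute)
  qed
  thus ?thesis
    unfolding closure_closed[OF closed_scalars] by blast
qed

text \<open>The two isometries are \<sigma>(S_1) and \<sigma>(S_n S_1), so this is the
  irreducibility of \<sigma>; it also gives that the polynomials have trivial commutant. Commuting
  with an isometry implies being fixed by the compression.\<close>

lemma scalar_if_commutes:
  assumes "y * (S 1 * S 1) = S 1 * S 1 * y" "y * (S 1 * S n * S 1) = S 1 * S n * S 1 * y"
  shows "\<exists>c. y = c *\<^sub>C 1"
proof (rule scalar_if_compressions_fix)
  have "(S 1)\<^sup>\<star> ^ 2 * y * S 1 ^ 2 = (S 1)\<^sup>\<star> ^ 2 * (y * (S 1 * S 1))"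
    by (simp add: power2_eq_square mult.assoc)
  also have "\<dots> = y"
    unfolding assms(1) by (simp add: power2_eq_square mult.assoc)
  finally show "(S 1)\<^sup>\<star> ^ 2 * y * S 1 ^ 2 = y" .
  have "(S 1 * S n * S 1)\<^sup>\<star> * y * (S 1 * S n * S 1) = (S 1 * S n * S 1)\<^sup>\<star> * (y * (S 1 * S n * S 1))"
    by (simp only: mult.assoc)
  also have "\<dots> = y"
    unfolding assms(2) by (simp add: star_mult mult.assoc)
  finally show "(S 1 * S n * S 1)\<^sup>\<star> * y * (S 1 * S n * S 1) = y" .
qed

text \<open>Compression by \<open>S 1 ^ (2 * k)\<close> gives
  \<open>\<zeta> ^ k *\<^sub>C y\<close>, which has to settle up to any \<epsilon>; but consecutive
  terms differ in norm by the constant \<bar>\<zeta> - 1\<bar> times \<open>norm y\<close>.\<close>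

lemma eq_0_if_twisted_commute_square:
  assumes "y * (S 1 * S 1) = \<zeta> *\<^sub>C (S 1 * S 1 * y)" "cmod \<zeta> = 1" "\<zeta> \<noteq> 1"
  shows "y = 0"
proof -
  have step: "(S 1)\<^sup>\<star> ^ 2 * y * S 1 ^ 2 = \<zeta> *\<^sub>C y"
  proof -
    have "(S 1)\<^sup>\<star> ^ 2 * y * S 1 ^ 2 = (S 1)\<^sup>\<star> ^ 2 * (y * (S 1 * S 1))"
      by (simp add: power2_eq_square mult.assoc)
    also have "\<dots> = \<zeta> *\<^sub>C y"
      unfolding assms(1) by (simp add: power2_eq_square mult.assoc mult_scaleC_right)
    finally show ?thesis .
  qed
  have comp: "(S 1)\<^sup>\<star> ^ (2 * k) * y * S 1 ^ (2 * k) = \<zeta> ^ k *\<^sub>C y" for k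
  proof (induction k)
    case (Suc k)
    have "(S 1)\<^sup>\<star> ^ (2 * Suc k) * y * S 1 ^ (2 * Suc k)
        = (S 1)\<^sup>\<star> ^ 2 * ((S 1)\<^sup>\<star> ^ (2 * k) * y * S 1 ^ (2 * k)) * S 1 ^ 2"
      by (rule compress_power_add)
    thus ?case
      using Suc step by (simp add: mult_scaleC_left mult_scaleC_right scaleC_scaleC mult.commute)
  qed simp
  have "norm ((\<zeta> - 1) *\<^sub>C y) \<le> 0"
  proof (rule field_le_epsilon)
    fix e :: real assume "0 < e"
    hence "0 < e / 2" by simp
    then obtain N t c where t: "\<And>k. k \<ge> N \<Longrightarrow> norm ((S 1)\<^sup>\<star> ^ k * y * S 1 ^ k - t) < e / 2"
      using compress_stabilise[of "e / 2" y] by blast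
    have "norm ((\<zeta> - 1) *\<^sub>C y) = norm (\<zeta> ^ N *\<^sub>C ((\<zeta> - 1) *\<^sub>C y))"
      using assms(2) by (simp add: norm_scaleC norm_mult norm_power)
    also have "\<zeta> ^ N *\<^sub>C ((\<zeta> - 1) *\<^sub>C y) = (\<zeta> ^ Suc N *\<^sub>C y - t) - (\<zeta> ^ N *\<^sub>C y - t)"
      by (simp add: scaleC_scaleC complex_vector.scale_left_diff_distrib
          complex_vector.scale_right_diff_distrib mult.commute)
    also have "norm \<dots> \<le> norm (\<zeta> ^ Suc N *\<^sub>C y - t) + norm (\<zeta> ^ N *\<^sub>C y - t)"
      by (rule norm_triangle_ineq4)
    also have "\<dots> \<le> e"
      using t[of "2 * Suc N"] t[of "2 * N"] comp[of "Suc N"] comp[of N] by simp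
    finally show "norm ((\<zeta> - 1) *\<^sub>C y) \<le> 0 + e"
      by simp
  qed
  thus ?thesis
    using assms(3) by simp
qed

text \<open>Iterating the relation shows that compression of \<open>R\<close> by
  \<open>S 1 ^ k\<close> is \<open>z ^ k *\<^sub>C (S 1 ^ k * R)\<close>. These terms settle up to
  any \<epsilon>, and consecutive ones differ in norm by exactly that of
  \<open>z *\<^sub>C (S 1 * R) - R\<close>.\<close>

lemma absorbs_if_twisted_intertwiner:
  assumes "R * S 1 = z *\<^sub>C (S 1 * S 1 * R)" "cmod z = 1"
  shows "R = z *\<^sub>C (S 1 * R)"
proof -
  have comm: "R * S 1 ^ k = z ^ k *\<^sub>C (S 1 ^ k * S 1 ^ k * R)" for k
  proof (induction k)
    case (Suc k)
    have "R * S 1 ^ Suc k = (R * S 1 ^ k) * S 1"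
      by (simp only: power_Suc2 mult.assoc)
    also have "\<dots> = z ^ k *\<^sub>C (S 1 ^ k * S 1 ^ k * (R * S 1))"
      by (simp only: Suc mult_scaleC_left mult.assoc)
    also have "\<dots> = z ^ Suc k *\<^sub>C (S 1 ^ k * (S 1 ^ k * S 1) * (S 1 * R))"
      by (simp add: assms(1) mult_scaleC_right scaleC_scaleC mult.commute mult.assoc)
    also have "S 1 ^ k * (S 1 ^ k * S 1) * (S 1 * R) = S 1 ^ k * (S 1 ^ k * S 1) * S 1 * R"
      by (simp only: mult.assoc)
    also have "S 1 ^ k * (S 1 ^ k * S 1) * S 1 = S 1 ^ Suc k * S 1 ^ Suc k"
      by (simp del: power_Suc flip: power_add power_Suc2)
    finally show ?case .
  qed simp
  have comp: "(S 1)\<^sup>\<star> ^ k * R * S 1 ^ k = z ^ k *\<^sub>C (S 1 ^ k * R)" for k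
  proof -
    have "(S 1)\<^sup>\<star> ^ k * R * S 1 ^ k = z ^ k *\<^sub>C (((S 1 ^ k)\<^sup>\<star> * S 1 ^ k) * S 1 ^ k * R)"
      by (simp only: mult.assoc comm mult_scaleC_right star_power)
    thus ?thesis
      by (simp add: S1_power_isometry)
  qed
  have "norm (z *\<^sub>C (S 1 * R) - R) \<le> 0"
  proof (rule field_le_epsilon)
    fix e :: real assume "0 < e"
    hence "0 < e / 2" by simp
    then obtain N t c where t: "\<And>k. k \<ge> N \<Longrightarrow> norm ((S 1)\<^sup>\<star> ^ k * R * S 1 ^ k - t) < e / 2"
      using compress_stabilise[of "e / 2" R] by blast
    have "norm (z *\<^sub>C (S 1 * R) - R) = norm (S 1 ^ N * (z *\<^sub>C (S 1 * R) - R))"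
      by (rule norm_isometry_mult[symmetric]) (rule S1_power_isometry)
    also have "\<dots> = norm (z ^ N *\<^sub>C (S 1 ^ N * (z *\<^sub>C (S 1 * R) - R)))"
      using assms(2) by (simp add: norm_scaleC norm_power)
    also have "z ^ N *\<^sub>C (S 1 ^ N * (z *\<^sub>C (S 1 * R) - R)) =
        (z ^ Suc N *\<^sub>C (S 1 ^ Suc N * R) - t) - (z ^ N *\<^sub>C (S 1 ^ N * R) - t)"
      by (simp only: power_Suc2) (simp add: right_diff_distrib complex_vector.scale_right_diff_distrib
          mult_scaleC_right scaleC_scaleC mult.assoc)
    also have "norm \<dots> \<le> norm (z ^ Suc N *\<^sub>C (S 1 ^ Suc N * R) - t) + norm (z ^ N *\<^sub>C (S 1 ^ N * R) - t)"
      by (rule norm_triangle_ineq4)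
    also have "\<dots> \<le> e"
      using t[of "Suc N"] t[of N] unfolding comp by simp
    finally show "norm (z *\<^sub>C (S 1 * R) - R) \<le> 0 + e"
      by simp
  qed
  thus ?thesis
    by simp
qed

end

section \<open>The endomorphism\<close>

locale star_hom =
  fixes f :: "'a::unital_cstar_algebra \<Rightarrow> 'b::unital_cstar_algebra"
  assumes unital_star_hom: "unital_star_hom f"
begin

lemma
  shows add: "f (x + y) = f x + f y"
    and scaleC: "f (a *\<^sub>C x) = a *\<^sub>C f x"
    and mult: "f (x * y) = f x * f y"
    and star: "f (x\<^sup>\<star>) = (f x)\<^sup>\<star>"
    and one [simp]: "f 1 = 1"
  using unital_star_hom by (simp_all add: unital_star_hom_def)

lemma zero [simp]: "f 0 = 0"
  using scaleC[of 0 0] by simp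

lemma diff: "f (x - y) = f x - f y"
  using add[of "x - y" y] by (simp add: algebra_simps)

lemma minus: "f (- x) = - f x"
  using diff[of 0 x] by simp

lemma sum: "f (sum g A) = (\<Sum>a\<in>A. f (g a))"
  by (induction A rule: infinite_finite_induct) (auto simp: add)

end

lemma unital_star_hom_compose:
  "unital_star_hom f \<Longrightarrow> unital_star_hom g \<Longrightarrow> unital_star_hom (\<lambda>x. f (g x))"
  by (simp add: unital_star_hom_def)

lemma unital_star_hom_id: "unital_star_hom (\<lambda>x. x)"
  by (simp add: unital_star_hom_def)

lemma unital_star_hom_inv:
  assumes "unital_star_hom f" "bij f"
  shows "unital_star_hom (inv f)"
proof -
  interpret star_hom f by standard fact
  have inv: "inv f y = x \<longleftrightarrow> f x = y" for x y
    using assms(2) by (metis bij_inv_eq_iff)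
  have [simp]: "f (inv f y) = y" for y
    using assms(2) by (simp add: bij_is_surj surj_f_inv_f)
  show ?thesis
    unfolding unital_star_hom_def inv by (simp add: add scaleC mult star)
qed

lemma cuntz_family_image:
  assumes "cuntz_family n S" "unital_star_hom f"
  shows "cuntz_family n (\<lambda>i. f (S i))"
proof -
  interpret cuntz_family n S by fact
  interpret star_hom f by standard fact
  show ?thesis
  proof
    show "2 \<le> n" by (rule n_ge_2)
    show "(f (S i))\<^sup>\<star> * f (S i) = 1" if "i \<in> {1..n}" for i
      using isometry[OF that] by (simp flip: star mult)
    show "(\<Sum>i=1..n. f (S i) * (f (S i))\<^sup>\<star>) = 1"
      using sum_ranges by (simp flip: star mult sum)
  qed
qed

section \<open>The endomorphism \<sigma>, its direct sum with identities, and the unitary inducing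
  it\<close>

context cuntz_family
begin

text \<open>The prescribed values of \<sigma>. The isometries \<open>S 1 * S i\<close> alone would
  fill only the range of \<open>S 1\<close>; the last one is modified to cover its complement
  too.\<close>

definition sheared_generator :: "nat \<Rightarrow> 'a" where
  "sheared_generator i = (if i = n then S 1 * S n * (S 1)\<^sup>\<star> + (1 - S 1 * (S 1)\<^sup>\<star>) else S 1 * S i)"

lemma sum_split_last:
  fixes F :: "nat \<Rightarrow> 'b::comm_monoid_add"
  shows "(\<Sum>i=1..n. F i) = (\<Sum>i=1..<n. F i) + F n"
  using n_ge_2 by (simp add: sum.last_plus add.commute)

lemma cuntz_family_sheared: "cuntz_family n sheared_generator"
proof
  show "2 \<le> n" by (rule n_ge_2)
  show "(sheared_generator i)\<^sup>\<star> * sheared_generator i = 1" if "i \<in> {1..n}" for i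
    using isometry[OF that]
    by (simp add: sheared_generator_def star_mult star_add star_diff star_star algebra_simps)
  have "sheared_generator n * (sheared_generator n)\<^sup>\<star> = S 1 * (S n * (S n)\<^sup>\<star>) * (S 1)\<^sup>\<star> + (1 - S 1 * (S 1)\<^sup>\<star>)"
    by (simp add: sheared_generator_def star_mult star_add star_diff star_star algebra_simps)
  moreover have "(\<Sum>i=1..<n. sheared_generator i * (sheared_generator i)\<^sup>\<star>)
      = S 1 * (\<Sum>i=1..<n. S i * (S i)\<^sup>\<star>) * (S 1)\<^sup>\<star>"
    unfolding sum_distrib_left sum_distrib_right
    by (intro sum.cong refl) (simp add: sheared_generator_def star_mult mult.assoc)
  ultimately have "(\<Sum>i=1..n. sheared_generator i * (sheared_generator i)\<^sup>\<star>)
      = S 1 * (\<Sum>i=1..n. S i * (S i)\<^sup>\<star>) * (S 1)\<^sup>\<star> + (1 - S 1 * (S 1)\<^sup>\<star>)"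
    by (simp only: sum_split_last distrib_left distrib_right) simp
  thus "(\<Sum>i=1..n. sheared_generator i * (sheared_generator i)\<^sup>\<star>) = 1"
    by (simp only: sum_ranges) simp
qed

text \<open>The direct sum of \<open>n - 1\<close> copies of the identity and one copy of \<open>\<sigma>\<close>.\<close>

definition amplify :: "('a \<Rightarrow> 'a) \<Rightarrow> 'a \<Rightarrow> 'a" where
  "amplify \<sigma> x = (\<Sum>i=1..<n. S i * x * (S i)\<^sup>\<star>) + S n * \<sigma> x * (S n)\<^sup>\<star>"

lemma amplify_mult_S:
  assumes "j \<in> {1..<n}"
  shows "amplify \<sigma> x * S j = S j * x"
proof -
  have "(\<Sum>i=1..<n. S i * x * (S i)\<^sup>\<star>) * S j = (\<Sum>i=1..<n. if i = j then S j * x else 0)"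
    unfolding sum_distrib_right
    by (intro sum.cong refl) (use assms in \<open>simp add: mult.assoc generator_star_mult\<close>)
  also have "\<dots> = S j * x"
    using assms by simp
  finally show ?thesis
    using assms by (simp add: amplify_def distrib_right mult.assoc generator_star_mult)
qed

lemma amplify_mult_Sn: "amplify \<sigma> x * S n = S n * \<sigma> x"
proof -
  have "(\<Sum>i=1..<n. S i * x * (S i)\<^sup>\<star>) * S n = (\<Sum>i=1..<n. 0)"
    unfolding sum_distrib_right by (intro sum.cong refl) (simp add: mult.assoc generator_star_mult)
  thus ?thesis
    by (simp add: amplify_def distrib_right mult.assoc)
qed

lemma S_star_mult_amplify:
  assumes "j \<in> {1..<n}"
  shows "(S j)\<^sup>\<star> * amplify \<sigma> x = x * (S j)\<^sup>\<star>"
proof -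
  have "(S j)\<^sup>\<star> * (\<Sum>i=1..<n. S i * x * (S i)\<^sup>\<star>) = (\<Sum>i=1..<n. if i = j then x * (S j)\<^sup>\<star> else 0)"
    unfolding sum_distrib_left
    by (intro sum.cong refl) (use assms in \<open>simp add: mult.assoc generator_star_mult_assoc\<close>)
  also have "\<dots> = x * (S j)\<^sup>\<star>"
    using assms by simp
  finally show ?thesis
    using assms by (simp add: amplify_def distrib_left mult.assoc generator_star_mult_assoc)
qed

lemma Sn_star_mult_amplify: "(S n)\<^sup>\<star> * amplify \<sigma> x = \<sigma> x * (S n)\<^sup>\<star>"
proof -
  have "(S n)\<^sup>\<star> * (\<Sum>i=1..<n. S i * x * (S i)\<^sup>\<star>) = (\<Sum>i=1..<n. 0)"
    unfolding sum_distrib_left by (intro sum.cong refl) (simp add: mult.assoc generator_star_mult_assoc)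
  thus ?thesis
    by (simp add: amplify_def distrib_left mult.assoc)
qed

lemma unital_star_hom_amplify:
  assumes "unital_star_hom \<sigma>"
  shows "unital_star_hom (amplify \<sigma>)"
proof -
  interpret star_hom \<sigma> by standard fact
  have "amplify \<sigma> x * amplify \<sigma> y = amplify \<sigma> (x * y)" for x y
  proof -
    have "amplify \<sigma> x * amplify \<sigma> y =
        (\<Sum>i=1..<n. (amplify \<sigma> x * S i) * y * (S i)\<^sup>\<star>) + (amplify \<sigma> x * S n) * \<sigma> y * (S n)\<^sup>\<star>"
      by (simp add: amplify_def[of _ y] distrib_left sum_distrib_left mult.assoc)
    also have "\<dots> = amplify \<sigma> (x * y)"
      unfolding amplify_def[of _ "x * y"] amplify_mult_Sn
      by (intro arg_cong2[of _ _ _ _ "(+)"] sum.cong refl) (simp_all add: amplify_mult_S mult mult.assoc)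
    finally show ?thesis .
  qed
  moreover have "amplify \<sigma> 1 = 1"
    using sum_ranges by (simp add: amplify_def sum_split_last)
  moreover have "amplify \<sigma> (x\<^sup>\<star>) = (amplify \<sigma> x)\<^sup>\<star>" for x
    by (simp add: amplify_def star star_add star_sum star_mult star_star mult.assoc)
  ultimately show ?thesis
    unfolding unital_star_hom_def
    by (simp add: amplify_def add scaleC distrib_left distrib_right sum.distrib mult_scaleC_left
        mult_scaleC_right scaleC_add_right complex_vector.scale_sum_right)
qed

text \<open>The u with \<rho> = \<lambda>_u.\<close>

definition hom_unitary :: "('a \<Rightarrow> 'a) \<Rightarrow> 'a" where
  "hom_unitary \<rho> = (\<Sum>i=1..n. \<rho> (S i) * (S i)\<^sup>\<star>)"

lemma hom_unitary_mult_S: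
  assumes "j \<in> {1..n}"
  shows "hom_unitary \<rho> * S j = \<rho> (S j)"
proof -
  have "hom_unitary \<rho> * S j = (\<Sum>i=1..n. if i = j then \<rho> (S j) else 0)"
    unfolding hom_unitary_def sum_distrib_right
    by (intro sum.cong refl) (use assms in \<open>simp add: mult.assoc generator_star_mult\<close>)
  thus ?thesis
    using assms by simp
qed

text \<open>It carries the Cuntz family \<open>S i\<close> to the family \<rho>(S_i), and its
  adjoint carries the latter back; both have ranges summing up to 1.\<close>

lemma cstar_unitary_hom_unitary:
  assumes "unital_star_hom \<rho>"
  shows "cstar_unitary (hom_unitary \<rho>)"
proof -
  interpret R: cuntz_family n "\<lambda>i. \<rho> (S i)"
    by (rule cuntz_family_image[OF cuntz_family_axioms assms])
  have star_u: "(hom_unitary \<rho>)\<^sup>\<star> = (\<Sum>i=1..n. S i * (\<rho> (S i))\<^sup>\<star>)"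
    by (simp add: hom_unitary_def star_sum star_mult star_star)
  have "hom_unitary \<rho> * (hom_unitary \<rho>)\<^sup>\<star> = (\<Sum>i=1..n. (hom_unitary \<rho> * S i) * (\<rho> (S i))\<^sup>\<star>)"
    by (simp add: star_u sum_distrib_left mult.assoc)
  also have "\<dots> = (\<Sum>i=1..n. \<rho> (S i) * (\<rho> (S i))\<^sup>\<star>)"
    by (intro sum.cong refl) (simp add: hom_unitary_mult_S)
  also have "\<dots> = 1"
    by (rule R.sum_ranges)
  finally have 1: "hom_unitary \<rho> * (hom_unitary \<rho>)\<^sup>\<star> = 1" .
  have "(hom_unitary \<rho>)\<^sup>\<star> * \<rho> (S j) = S j" if "j \<in> {1..n}" for j
  proof -
    have "(hom_unitary \<rho>)\<^sup>\<star> * \<rho> (S j) = (\<Sum>i=1..n. if i = j then S j else 0)"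
      unfolding star_u sum_distrib_right
      by (intro sum.cong refl) (use that in \<open>simp add: mult.assoc R.generator_star_mult\<close>)
    thus ?thesis
      using that by simp
  qed
  hence "(\<Sum>j=1..n. ((hom_unitary \<rho>)\<^sup>\<star> * \<rho> (S j)) * (S j)\<^sup>\<star>) = (\<Sum>j=1..n. S j * (S j)\<^sup>\<star>)"
    by (intro sum.cong refl) simp
  hence "(hom_unitary \<rho>)\<^sup>\<star> * hom_unitary \<rho> = 1"
    unfolding sum_ranges by (simp add: hom_unitary_def[of \<rho>, THEN arg_cong[where f = "(*) _"]] sum_distrib_left mult.assoc)
  with 1 show ?thesis
    by (simp add: cstar_unitary_def)
qed

definition is_word_sum :: "'a \<Rightarrow> bool" where
  "is_word_sum x \<longleftrightarrow> (\<exists>ps. set ps \<subseteq> words n \<times> words n \<and>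
     x = (\<Sum>(\<alpha>, \<beta>)\<leftarrow>ps. word_isometry S \<alpha> * (word_isometry S \<beta>)\<^sup>\<star>))"

lemma is_word_sum_word:
  "\<alpha> \<in> words n \<Longrightarrow> \<beta> \<in> words n \<Longrightarrow> is_word_sum (word_isometry S \<alpha> * (word_isometry S \<beta>)\<^sup>\<star>)"
  unfolding is_word_sum_def by (intro exI[of _ "[(\<alpha>, \<beta>)]"]) auto

lemma is_word_sum_add: "is_word_sum x \<Longrightarrow> is_word_sum y \<Longrightarrow> is_word_sum (x + y)"
proof -
  assume "is_word_sum x" "is_word_sum y"
  then obtain ps qs where
    "set ps \<subseteq> words n \<times> words n" "x = (\<Sum>(\<alpha>, \<beta>)\<leftarrow>ps. word_isometry S \<alpha> * (word_isometry S \<beta>)\<^sup>\<star>)"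
    "set qs \<subseteq> words n \<times> words n" "y = (\<Sum>(\<alpha>, \<beta>)\<leftarrow>qs. word_isometry S \<alpha> * (word_isometry S \<beta>)\<^sup>\<star>)"
    unfolding is_word_sum_def by blast
  thus ?thesis
    unfolding is_word_sum_def by (intro exI[of _ "ps @ qs"]) auto
qed

lemma is_word_sum_sum: "(\<And>i. i \<in> A \<Longrightarrow> is_word_sum (f i)) \<Longrightarrow> is_word_sum (sum f A)"
proof (induction A rule: infinite_finite_induct)
  case (insert a A)
  thus ?case
    by (simp add: is_word_sum_add)
qed (auto simp: is_word_sum_def intro!: exI[of _ "[]"])

lemma is_word_sum_hom_unitary:
  assumes "\<And>i. i \<in> {1..n} \<Longrightarrow> \<sigma> (S i) = sheared_generator i"
  shows "is_word_sum (hom_unitary (amplify \<sigma>))"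
proof -
  have first: "is_word_sum (\<Sum>j=1..<n. S j * S i * (S j)\<^sup>\<star> * (S i)\<^sup>\<star>)" if "i \<in> {1..n}" for i
  proof (rule is_word_sum_sum)
    fix j assume "j \<in> {1..<n}"
    thus "is_word_sum (S j * S i * (S j)\<^sup>\<star> * (S i)\<^sup>\<star>)"
      using that is_word_sum_word[of "[j, i]" "[i, j]"] by (simp add: star_mult mult.assoc)
  qed
  have second: "is_word_sum (S n * sheared_generator i * (S n)\<^sup>\<star> * (S i)\<^sup>\<star>)" if i: "i \<in> {1..n}" for i
  proof (cases "i = n")
    case False
    thus ?thesis
      using i is_word_sum_word[of "[n, 1, i]" "[i, n]"]
      by (simp add: sheared_generator_def star_mult mult.assoc)
  next
    case True
    \<comment> \<open>Word sums have no negative coefficients, so the complement is rewritten as the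
      sum of the other range projections.\<close>
    have "1 - S 1 * (S 1)\<^sup>\<star> = (\<Sum>i\<in>{1..n} - {1}. S i * (S i)\<^sup>\<star>)"
      using sum_ranges by (simp add: sum.remove[of _ 1] algebra_simps)
    hence "S n * sheared_generator i * (S n)\<^sup>\<star> * (S i)\<^sup>\<star> = S n * S 1 * S n * (S n * S n * S 1)\<^sup>\<star> +
        (\<Sum>i\<in>{1..n} - {1}. S n * S i * (S n * S n * S i)\<^sup>\<star>)"
      by (simp add: True sheared_generator_def star_mult distrib_left distrib_right
          sum_distrib_left sum_distrib_right mult.assoc)
    moreover have "is_word_sum (S n * S 1 * S n * (S n * S n * S 1)\<^sup>\<star>)"
      using is_word_sum_word[of "[n, 1, n]" "[n, n, 1]"] by (simp add: mult.assoc)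
    moreover have "is_word_sum (S n * S i * (S n * S n * S i)\<^sup>\<star>)" if "i \<in> {1..n} - {1}" for i
      using that is_word_sum_word[of "[n, i]" "[n, n, i]"] by (simp add: mult.assoc)
    ultimately show ?thesis
      by (simp only:) (intro is_word_sum_add is_word_sum_sum)
  qed
  have "hom_unitary (amplify \<sigma>) = (\<Sum>i=1..n. (\<Sum>j=1..<n. S j * S i * (S j)\<^sup>\<star> * (S i)\<^sup>\<star>) +
      S n * sheared_generator i * (S n)\<^sup>\<star> * (S i)\<^sup>\<star>)"
    unfolding hom_unitary_def
    by (intro sum.cong refl) (simp add: amplify_def assms distrib_right sum_distrib_right)
  thus ?thesis
    by (simp only:) (intro is_word_sum_sum is_word_sum_add first second)
qed


lemma generators_nonzero: "S 1 \<noteq> 0" "S n \<noteq> 0"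
  by (metis S1_isometry(1) mult_zero_right zero_neq_one) (metis Sn_isometry(1) mult_zero_right zero_neq_one)

text \<open>In the second equation the summand \<open>1 - S 1 * (S 1)\<^sup>\<star>\<close> of
  \<sigma>(S_n) is killed by \<sigma>(S_1) = S_1 S_1.\<close>

lemma sheared_hom_S1:
  assumes "unital_star_hom \<sigma>" "\<And>i. i \<in> {1..n} \<Longrightarrow> \<sigma> (S i) = sheared_generator i"
  shows "\<sigma> (S 1) = S 1 * S 1" "\<sigma> (S n * S 1) = S 1 * S n * S 1"
proof -
  interpret star_hom \<sigma> by standard fact
  show *: "\<sigma> (S 1) = S 1 * S 1"
    using assms(2)[of 1] by (simp add: sheared_generator_def)
  show "\<sigma> (S n * S 1) = S 1 * S n * S 1"
    using assms(2)[of n] by (simp add: * mult sheared_generator_def distrib_left distrib_right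
        left_diff_distrib right_diff_distrib mult.assoc)
qed

section \<open>Polynomials under \<sigma> and under gauge maps\<close>

lemma word_polys_image:
  assumes "unital_star_hom f" "\<And>i. i \<in> {1..n} \<Longrightarrow> f (S i) \<in> word_polys" "x \<in> word_polys"
  shows "f x \<in> word_polys"
proof -
  interpret star_hom f by standard fact
  have word: "f (word_isometry S \<mu>) \<in> word_polys" if "\<mu> \<in> words n" for \<mu>
    using that by (induction \<mu>) (auto simp: mult assms(2) intro!: word_polys_mult word_polys_1)
  show ?thesis
    using assms(3)
  proof (induction rule: word_polys_induct)
    case (word \<alpha> \<beta>)
    thus ?case
      using \<open>\<And>\<mu>. \<mu> \<in> words n \<Longrightarrow> f (word_isometry S \<mu>) \<in> word_polys\<close>
      by (simp add: mult star word_polys_mult word_polys_star)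
  qed (use word_polys_subspace in \<open>auto simp: add scaleC complex_vector.subspace_def\<close>)
qed

lemma sheared_generator_in_word_polys:
  assumes "i \<in> {1..n}"
  shows "sheared_generator i \<in> word_polys"
proof -
  have gen: "S 1 \<in> word_polys" "S n \<in> word_polys" "S i \<in> word_polys"
    using assms by (auto intro: word_polys_generator)
  thus ?thesis
    unfolding sheared_generator_def
    by (auto intro!: word_polys_mult word_polys_star word_polys_1
        complex_vector.subspace_add[OF word_polys_subspace] complex_vector.subspace_diff[OF word_polys_subspace])
qed

text \<open>Every word S_\<alpha> S_\<beta>* is an eigenvector of \<gamma>; its eigenvalue has
  modulus 1, so its conjugate, \<open>c\<close> in the proof, is the inverse.\<close>

lemma gauge_onto_word_polys:
  assumes "unital_star_hom \<gamma>" "\<And>i. i \<in> {1..n} \<Longrightarrow> \<gamma> (S i) = z *\<^sub>C S i" "cmod z = 1" "x \<in> word_polys"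
  shows "\<exists>y\<in>word_polys. \<gamma> y = x"
  using assms(4)
proof (induction rule: word_polys_induct)
  interpret star_hom \<gamma> by standard fact
  have zz: "z * cnj z = 1" "cnj z * z = 1"
    using assms(3) by (simp_all add: complex_norm_square[symmetric] mult.commute)
  have word_gauge: "\<gamma> (word_isometry S \<mu>) = z ^ length \<mu> *\<^sub>C word_isometry S \<mu>" if "\<mu> \<in> words n" for \<mu>
    using that
    by (induction \<mu>) (auto simp: mult assms(2) mult_scaleC_left mult_scaleC_right scaleC_scaleC mult.commute)
  {
    case (word \<alpha> \<beta>)
    define c where "c = cnj z ^ length \<alpha> * z ^ length \<beta>"
    have "c * (z ^ length \<alpha> * cnj z ^ length \<beta>) = (z * cnj z) ^ length \<alpha> * (z * cnj z) ^ length \<beta>"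
      by (simp add: c_def power_mult_distrib algebra_simps)
    hence "c * (cnj z ^ length \<beta> * z ^ length \<alpha>) = 1"
      by (simp add: zz mult.commute)
    hence "\<gamma> (c *\<^sub>C (word_isometry S \<alpha> * (word_isometry S \<beta>)\<^sup>\<star>)) = word_isometry S \<alpha> * (word_isometry S \<beta>)\<^sup>\<star>"
      using word by (simp add: scaleC mult star word_gauge star_scaleC mult_scaleC_left mult_scaleC_right
          scaleC_scaleC mult.assoc)
    moreover have "c *\<^sub>C (word_isometry S \<alpha> * (word_isometry S \<beta>)\<^sup>\<star>) \<in> word_polys"
      using word by (intro complex_vector.subspace_scale word_polys_subspace word_polys_words)
    ultimately show ?case
      by blast
  next
    case zero
    show ?case
      using complex_vector.subspace_0[OF word_polys_subspace] zero by (intro bexI[of _ 0]) auto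
  next
    case (add x y)
    thus ?case
      using complex_vector.subspace_add[OF word_polys_subspace] by (metis star_hom.add star_hom_axioms)
  next
    case (scale c x)
    thus ?case
      using complex_vector.subspace_scale[OF word_polys_subspace] by (metis scaleC)
  }
qed

end

section \<open>Rigidity of extended gauge actions\<close>

context generating_cuntz_family
begin

lemma scalar_if_commutes_word_polys:
  assumes "\<And>x. x \<in> word_polys \<Longrightarrow> y * x = x * y"
  shows "\<exists>c. y = c *\<^sub>C 1"
  by (rule scalar_if_commutes) (intro assms word_polys_mult word_polys_generator; simp)+

text \<open>Combining \<open>R = z *\<^sub>C (S 1 * R)\<close> with the hypothesis gives
  \<open>R * S 1 = cnj z *\<^sub>C R\<close>. If \<open>R\<^sup>\<star> * R\<close> were a nonzero
  scalar, \<open>R\<close> could be cancelled and \<open>S 1\<close> would be a scalar, contrary to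
  \<open>(S n)\<^sup>\<star> * S 1 = 0\<close>.\<close>

lemma twisted_intertwiner_eq_0:
  assumes R: "R * S 1 = z *\<^sub>C (S 1 * S 1 * R)" and z: "cmod z = 1" and scalar: "R\<^sup>\<star> * R = c *\<^sub>C 1"
  shows "R = 0"
proof (rule ccontr)
  assume "R \<noteq> 0"
  have zz: "z * cnj z = 1" "cnj z * z = 1"
    using z by (simp_all add: complex_norm_square[symmetric] mult.commute)
  have abs: "R = z *\<^sub>C (S 1 * R)"
    by (rule absorbs_if_twisted_intertwiner[OF R z])
  have "R * S 1 = S 1 * (z *\<^sub>C (S 1 * R))"
    by (simp only: R mult_scaleC_right mult.assoc)
  also have "\<dots> = S 1 * R"
    by (simp only: abs[symmetric])
  also have "\<dots> = cnj z *\<^sub>C (z *\<^sub>C (S 1 * R))"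
    by (simp add: scaleC_scaleC zz)
  also have "\<dots> = cnj z *\<^sub>C R"
    by (simp only: abs[symmetric])
  finally have "R * (S 1 - cnj z *\<^sub>C 1) = 0"
    by (simp add: right_diff_distrib mult_scaleC_right)
  hence "(R\<^sup>\<star> * R) * (S 1 - cnj z *\<^sub>C 1) = 0"
    by (simp only: mult.assoc mult_zero_right)
  hence "c *\<^sub>C (S 1 - cnj z *\<^sub>C 1) = 0"
    by (simp only: scalar mult_scaleC_left mult_1_left)
  moreover have "c \<noteq> 0"
    using scalar \<open>R \<noteq> 0\<close> by (auto simp: star_mult_self_eq_0_iff)
  ultimately have "S 1 = cnj z *\<^sub>C 1"
    by simp
  hence "cnj z *\<^sub>C (S n)\<^sup>\<star> = 0"
    using Sn_S1(1) by (simp add: mult_scaleC_right)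
  thus False
    using z generators_nonzero by auto
qed

text \<open>If some \<open>S\<^sub>i\<^sup>\<star> g(S\<^sub>j)\<close> were nonzero, \<open>g\<close> would be an inner perturbation of \<open>\<gamma>\<close>. Comparing the
  images of \<open>S\<^sub>n\<close> would then give a nonzero intertwiner from \<open>\<gamma>\<sigma>\<gamma>\<^sup>-\<^sup>1\<close> to the identity or to \<open>\<sigma>\<close>,
  whereas \<open>S\<^sub>1\<close> and \<open>\<sigma>(S\<^sub>1) = S\<^sub>1\<^sup>2\<close> have different degrees.\<close>

lemma gauge_extension_corner:
  assumes \<sigma>: "unital_star_hom \<sigma>" "\<And>i. i \<in> {1..n} \<Longrightarrow> \<sigma> (S i) = sheared_generator i"
    and \<gamma>: "unital_star_hom \<gamma>" "\<And>i. i \<in> {1..n} \<Longrightarrow> \<gamma> (S i) = z *\<^sub>C S i" and z: "cmod z = 1" "z \<noteq> 1"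
    and g: "unital_star_hom g" "bij g"
    and equivariant: "\<And>x. x \<in> word_polys \<Longrightarrow> g (amplify \<sigma> x) = amplify \<sigma> (\<gamma> x)"
    and i: "i \<in> {1..<n}" and j: "j \<in> {1..<n}"
  shows "(S i)\<^sup>\<star> * g (S j) = 0"
proof (rule ccontr)
  interpret \<sigma>: star_hom \<sigma> by standard fact
  interpret \<gamma>: star_hom \<gamma> by standard fact
  interpret g: star_hom g by standard fact
  have zz: "z * cnj z = 1" "cnj z * z = 1"
    using z(1) by (simp_all add: complex_norm_square[symmetric] mult.commute)
  have \<gamma>_polys: "\<gamma> x \<in> word_polys" if "x \<in> word_polys" for x
    by (rule word_polys_image[OF \<gamma>(1) _ that])
      (auto simp: \<gamma>(2) intro!: complex_vector.subspace_scale word_polys_subspace word_polys_generator)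
  have \<sigma>_polys: "\<sigma> x \<in> word_polys" if "x \<in> word_polys" for x
    by (rule word_polys_image[OF \<sigma>(1) _ that]) (auto simp: \<sigma>(2) intro!: sheared_generator_in_word_polys)
  have scalar: "\<exists>c. y = c *\<^sub>C 1" if "\<And>x. x \<in> word_polys \<Longrightarrow> y * \<gamma> x = \<gamma> x * y" for y
    using gauge_onto_word_polys[OF \<gamma> z(1)] that by (intro scalar_if_commutes_word_polys) metis
  have S1: "S 1 \<in> word_polys"
    by (intro word_polys_generator) simp
  have \<sigma>_S1: "\<sigma> (S 1) = S 1 * S 1"
    using \<sigma> by (rule sheared_hom_S1)
  have \<gamma>_S1: "\<gamma> (S 1) = z *\<^sub>C S 1"
    by (rule \<gamma>(2)) simp
  define y where "y = (S i)\<^sup>\<star> * g (S j)"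
  assume "(S i)\<^sup>\<star> * g (S j) \<noteq> 0"
  hence "y \<noteq> 0"
    by (simp add: y_def)
  \<comment> \<open>Since \<open>i\<close> and \<open>j\<close> are below \<open>n\<close>, both
    generators belong to identity summands, so \<open>y\<close> intertwines \<open>g\<close> and
    \<gamma>.\<close>
  have y_g: "y * g x = \<gamma> x * y" if x: "x \<in> word_polys" for x
  proof -
    have "y * g x = (S i)\<^sup>\<star> * g (amplify \<sigma> x * S j)"
      by (simp add: y_def amplify_mult_S[OF j] g.mult mult.assoc)
    also have "\<dots> = ((S i)\<^sup>\<star> * amplify \<sigma> (\<gamma> x)) * g (S j)"
      by (simp add: g.mult equivariant[OF x] mult.assoc)
    also have "\<dots> = \<gamma> x * y"
      by (simp add: S_star_mult_amplify[OF i] y_def mult.assoc)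
    finally show ?thesis .
  qed
  have y_star: "y\<^sup>\<star> * \<gamma> x = g x * y\<^sup>\<star>" if x: "x \<in> word_polys" for x
    using arg_cong[OF y_g[OF word_polys_star[OF x]], of star] by (simp add: star_mult star_star g.star \<gamma>.star)
  \<comment> \<open>\<open>y\<^sup>\<star> * y\<close> commutes with the image of the polynomials
    under \<open>g\<close>. Its preimage under \<open>g\<close> therefore commutes with all
    polynomials and is scalar.\<close>
  obtain a where a: "y\<^sup>\<star> * y = a *\<^sub>C 1"
  proof -
    obtain y' where y': "g y' = y\<^sup>\<star> * y"
      using g(2) by (metis bij_pointE)
    have "y' * x = x * y'" if x: "x \<in> word_polys" for x
    proof -
      have "g (y' * x) = y\<^sup>\<star> * (y * g x)"
        by (simp add: g.mult y' mult.assoc)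
      also have "\<dots> = g x * (y\<^sup>\<star> * y)"
        by (simp add: y_g[OF x] y_star[OF x] flip: mult.assoc)
      finally have "g (y' * x) = g (x * y')"
        by (simp add: g.mult y')
      thus ?thesis
        using g(2) by (simp add: bij_is_inj inj_eq)
    qed
    then obtain a where "y' = a *\<^sub>C 1"
      using scalar_if_commutes_word_polys by blast
    hence "y\<^sup>\<star> * y = a *\<^sub>C 1"
      using y' by (simp add: g.scaleC)
    thus thesis
      by (rule that)
  qed
  have "a \<noteq> 0"
    using a \<open>y \<noteq> 0\<close> by (auto simp: star_mult_self_eq_0_iff)
  \<comment> \<open>\<open>T k\<close> intertwines \<gamma>\<sigma> with \<gamma> for k < n, and
    with \<sigma>\<gamma> for k = n. Both cases are excluded by comparing degrees at
    \<open>S 1\<close>.\<close>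
  define T where "T k = (S k)\<^sup>\<star> * g (S n) * y\<^sup>\<star>" for k
  have T_eq: "T k * \<gamma> (\<sigma> x) = (S k)\<^sup>\<star> * amplify \<sigma> (\<gamma> x) * (g (S n) * y\<^sup>\<star>)" if x: "x \<in> word_polys" for k x
  proof -
    have "T k * \<gamma> (\<sigma> x) = (S k)\<^sup>\<star> * g (S n * \<sigma> x) * y\<^sup>\<star>"
      by (simp add: T_def y_star[OF \<sigma>_polys[OF x]] g.mult mult.assoc)
    also have "\<dots> = (S k)\<^sup>\<star> * g (amplify \<sigma> x * S n) * y\<^sup>\<star>"
      by (simp only: amplify_mult_Sn)
    finally show ?thesis
      by (simp add: g.mult equivariant[OF x] mult.assoc)
  qed
  have Tk: "T k = 0" if k: "k \<in> {1..<n}" for k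
  proof -
    have T_\<gamma>: "T k * \<gamma> (\<sigma> x) = \<gamma> x * T k" if x: "x \<in> word_polys" for x
      by (simp add: T_eq[OF x] S_star_mult_amplify[OF k]) (simp add: T_def mult.assoc)
    define R where "R = (T k)\<^sup>\<star>"
    have R_\<gamma>: "\<gamma> (\<sigma> x) * R = R * \<gamma> x" if x: "x \<in> word_polys" for x
      using arg_cong[OF T_\<gamma>[OF word_polys_star[OF x]], of star]
      by (simp add: R_def star_mult star_star \<gamma>.star \<sigma>.star)
    have "R\<^sup>\<star> * R * \<gamma> x = \<gamma> x * (R\<^sup>\<star> * R)" if x: "x \<in> word_polys" for x
    proof -
      have "R\<^sup>\<star> * R * \<gamma> x = (T k * \<gamma> (\<sigma> x)) * R"
        by (simp add: R_def[symmetric] R_\<gamma>[OF x] mult.assoc) (simp add: R_def star_star)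
      thus ?thesis
        by (simp add: T_\<gamma>[OF x] R_def star_star mult.assoc)
    qed
    then obtain c where c: "R\<^sup>\<star> * R = c *\<^sub>C 1"
      using scalar by blast
    have "(z * z) *\<^sub>C (S 1 * S 1 * R) = z *\<^sub>C (R * S 1)"
      using R_\<gamma>[OF S1]
      by (simp add: \<sigma>_S1 \<gamma>_S1 \<gamma>.mult mult_scaleC_left mult_scaleC_right scaleC_scaleC)
    hence "cnj z *\<^sub>C ((z * z) *\<^sub>C (S 1 * S 1 * R)) = cnj z *\<^sub>C (z *\<^sub>C (R * S 1))"
      by simp
    hence "R * S 1 = z *\<^sub>C (S 1 * S 1 * R)"
      by (simp add: scaleC_scaleC zz flip: mult.assoc[of "cnj z"])
    hence "R = 0"
      using z(1) c by (rule twisted_intertwiner_eq_0)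
    thus ?thesis
      by (simp add: R_def)
  qed
  \<comment> \<open>Here \<gamma>\<sigma>(S_1) carries the factor z^2, but \<sigma>\<gamma>(S_1)
    only z; the quotient \<open>cnj z\<close> is the twist.\<close>
  have Tn: "T n = 0"
  proof -
    have "T n * \<gamma> (\<sigma> (S 1)) = \<sigma> (\<gamma> (S 1)) * T n"
      by (simp add: T_eq[OF S1] Sn_star_mult_amplify) (simp add: T_def mult.assoc)
    hence "(z * z) *\<^sub>C (T n * (S 1 * S 1)) = z *\<^sub>C (S 1 * S 1 * T n)"
      by (simp add: \<sigma>_S1 \<gamma>_S1 \<gamma>.mult \<sigma>.scaleC mult_scaleC_left mult_scaleC_right scaleC_scaleC)
    hence "(cnj z * cnj z) *\<^sub>C ((z * z) *\<^sub>C (T n * (S 1 * S 1))) = (cnj z * cnj z) *\<^sub>C (z *\<^sub>C (S 1 * S 1 * T n))"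
      by simp
    moreover have "cnj z * cnj z * (z * z) = 1" "cnj z * cnj z * z = cnj z"
      using zz by (simp_all add: mult.assoc) (simp_all flip: mult.assoc)
    ultimately have "T n * (S 1 * S 1) = cnj z *\<^sub>C (S 1 * S 1 * T n)"
      by (simp add: scaleC_scaleC)
    moreover have "cnj z \<noteq> 1"
      using z(2) by (metis complex_cnj_cnj complex_cnj_one)
    ultimately show ?thesis
      using z(1) by (intro eq_0_if_twisted_commute_square[where \<zeta> = "cnj z"]) auto
  qed
  \<comment> \<open>The \<open>T k\<close> are all the coordinates of
    \<open>g (S n) * y\<^sup>\<star>\<close>, which thus vanishes. As
    \<open>y\<^sup>\<star> * y\<close> is a nonzero scalar, \<open>g (S n)\<close> would be 0,
    impossible for an isometry.\<close>
  have "g (S n) * y\<^sup>\<star> = (\<Sum>k=1..n. S k * (S k)\<^sup>\<star>) * (g (S n) * y\<^sup>\<star>)"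
    by (simp only: sum_ranges mult_1_left)
  also have "\<dots> = (\<Sum>k=1..n. S k * T k)"
    unfolding sum_distrib_right by (simp add: T_def mult.assoc)
  also have "\<dots> = 0"
    using Tk Tn by (simp add: sum_split_last)
  finally have "g (S n) * (y\<^sup>\<star> * y) = 0"
    by (simp flip: mult.assoc)
  hence "g (S n) = 0"
    using \<open>a \<noteq> 0\<close> by (simp add: a mult_scaleC_right)
  hence "g ((S n)\<^sup>\<star> * S n) = 0"
    by (simp only: g.mult mult_zero_right)
  thus False
    by simp
qed

text \<open>By the corner lemma the projection \<open>q = g p\<close> lies below \<open>e\<close>.
  It commutes with the range of \<open>amplify \<sigma>\<close> on polynomials, so irreducibility of
  \<sigma> makes it a multiple of \<open>e\<close>, and a nonzero projection of that form is
  \<open>e\<close>.\<close>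

lemma gauge_extension_flips:
  assumes \<sigma>: "unital_star_hom \<sigma>" "\<And>i. i \<in> {1..n} \<Longrightarrow> \<sigma> (S i) = sheared_generator i"
    and \<gamma>: "unital_star_hom \<gamma>" "\<And>i. i \<in> {1..n} \<Longrightarrow> \<gamma> (S i) = z *\<^sub>C S i" and z: "cmod z = 1" "z \<noteq> 1"
    and g: "unital_star_hom g" "bij g"
    and equivariant: "\<And>x. x \<in> word_polys \<Longrightarrow> g (amplify \<sigma> x) = amplify \<sigma> (\<gamma> x)"
  shows "g (1 - S n * (S n)\<^sup>\<star>) = S n * (S n)\<^sup>\<star>"
proof -
  interpret g: star_hom g by standard fact
  define e where "e = S n * (S n)\<^sup>\<star>"
  define p where "p = 1 - e"
  define q where "q = g p"
  have e: "e * e = e" "e\<^sup>\<star> = e" "e \<noteq> 0" "e \<noteq> 1"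
  proof -
    show "e * e = e" "e\<^sup>\<star> = e"
      by (simp_all add: e_def star_mult star_star mult.assoc)
    have "(S n)\<^sup>\<star> * e * S n = 1" "e * S 1 = 0"
      by (simp_all add: e_def mult.assoc)
    thus "e \<noteq> 0" "e \<noteq> 1"
      using generators_nonzero by auto
  qed
  have p_sum: "p = (\<Sum>i=1..<n. S i * (S i)\<^sup>\<star>)"
    using sum_ranges by (simp add: p_def e_def sum_split_last algebra_simps)
  have p: "p * p = p" "p\<^sup>\<star> = p"
    by (simp_all add: p_def algebra_simps e star_diff)
  have q: "q * q = q" "q\<^sup>\<star> = q"
    by (simp_all add: q_def p flip: g.mult g.star)
  \<comment> \<open>Expanding both projections into range projections leaves only the corners
    \<open>(S i)\<^sup>\<star> * g (S j)\<close> with i, j < n.\<close>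
  have "p * q = (\<Sum>i=1..<n. \<Sum>j=1..<n. S i * ((S i)\<^sup>\<star> * g (S j)) * g ((S j)\<^sup>\<star>))"
    by (simp add: q_def p_sum g.sum g.mult sum_distrib_left sum_distrib_right mult.assoc)
      (rule sum.swap)
  also have "\<dots> = (\<Sum>i=1..<n. \<Sum>j=1..<n. 0)"
  proof (intro sum.cong refl)
    fix i j assume ij: "i \<in> {1..<n}" "j \<in> {1..<n}"
    have "(S i)\<^sup>\<star> * g (S j) = 0"
      by (rule gauge_extension_corner[OF \<sigma> \<gamma> z g equivariant ij])
    thus "S i * ((S i)\<^sup>\<star> * g (S j)) * g ((S j)\<^sup>\<star>) = 0"
      by (simp only: mult_zero_left mult_zero_right)
  qed
  finally have pq: "p * q = 0"
    by simp
  have "q * p = (p * q)\<^sup>\<star>"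
    by (simp add: star_mult p q)
  hence qp: "q * p = 0"
    by (simp add: pq)
  have "q = e * q * e"
    using pq qp by (simp add: p_def algebra_simps)
  have q_comm: "q * amplify \<sigma> x = amplify \<sigma> x * q" if x: "x \<in> word_polys" for x
  proof -
    obtain x' where x': "x' \<in> word_polys" "\<gamma> x' = x"
      using gauge_onto_word_polys[OF \<gamma> z(1) x] by blast
    have "p * amplify \<sigma> x' = amplify \<sigma> x' * p"
    proof -
      have "e * amplify \<sigma> x' = amplify \<sigma> x' * e"
        by (simp add: e_def Sn_star_mult_amplify mult.assoc)
          (simp add: amplify_mult_Sn flip: mult.assoc)
      thus ?thesis
        by (simp add: p_def algebra_simps)
    qed
    hence "g (p * amplify \<sigma> x') = g (amplify \<sigma> x' * p)"
      by simp
    thus ?thesis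
      by (simp add: q_def g.mult equivariant x')
  qed
  \<comment> \<open>The block of \<open>q\<close> on the summand \<sigma>; it commutes with \<sigma>
    of every polynomial.\<close>
  define d where "d = (S n)\<^sup>\<star> * q * S n"
  have d_comm: "d * \<sigma> x = \<sigma> x * d" if x: "x \<in> word_polys" for x
  proof -
    have "d * \<sigma> x = (S n)\<^sup>\<star> * (q * amplify \<sigma> x) * S n"
      by (simp add: d_def mult.assoc amplify_mult_Sn)
    also have "\<dots> = ((S n)\<^sup>\<star> * amplify \<sigma> x) * q * S n"
      by (simp only: q_comm[OF x] mult.assoc)
    also have "\<dots> = \<sigma> x * d"
      by (simp only: Sn_star_mult_amplify d_def mult.assoc)
    finally show ?thesis .
  qed
  have "S 1 \<in> word_polys" "S n * S 1 \<in> word_polys"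
    by (intro word_polys_mult word_polys_generator; simp)+
  moreover have "\<sigma> (S 1) = S 1 * S 1"
    using \<sigma> by (rule sheared_hom_S1)
  moreover have "\<sigma> (S n * S 1) = S 1 * S n * S 1"
    using \<sigma> by (rule sheared_hom_S1)
  ultimately have "d * (S 1 * S 1) = S 1 * S 1 * d" "d * (S 1 * S n * S 1) = S 1 * S n * S 1 * d"
    using d_comm[of "S 1"] d_comm[of "S n * S 1"] by simp_all
  then obtain c where c: "d = c *\<^sub>C 1"
    using scalar_if_commutes by blast
  have "e * q * e = S n * d * (S n)\<^sup>\<star>"
    by (simp add: e_def d_def mult.assoc)
  hence q_eq: "q = c *\<^sub>C e"
    using \<open>q = e * q * e\<close> by (simp add: c e_def mult_scaleC_left mult_scaleC_right)
  have "q \<noteq> 0"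
  proof
    assume "q = 0"
    hence "g p = g 0"
      by (simp add: q_def)
    hence "p = 0"
      using g(2) by (simp add: bij_is_inj inj_eq del: g.zero)
    thus False
      using e(4) by (simp add: p_def)
  qed
  have "(c * c - c) *\<^sub>C e = q * q - q"
    by (simp add: q_eq mult_scaleC_left mult_scaleC_right scaleC_scaleC e complex_vector.scale_left_diff_distrib)
  hence "c * c = c"
    using e(3) by (simp add: q)
  hence "c = 1"
    using \<open>q \<noteq> 0\<close> q_eq by auto
  thus ?thesis
    using q_eq by (simp add: q_def p_def e_def)
qed

end

section \<open>The contradiction from the gauge automorphisms at \<open>\<i>\<close> and -1\<close>

lemma cuntz_algebra_generating:
  assumes "2 \<le> n" "cuntz_algebra n S"
  shows "generating_cuntz_family n S"
  using assms by unfold_locales (auto simp: cuntz_algebra_def cstar_isometry_def)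

text \<open>The norm bounds carry the agreement from the polynomials to their closure.\<close>

lemma (in generating_cuntz_family) contractive_hom_eqI:
  assumes "unital_star_hom f" "unital_star_hom h" "\<And>i. i \<in> {1..n} \<Longrightarrow> f (S i) = h (S i)"
    and "\<And>x. norm (f x) \<le> norm x" "\<And>x. norm (h x) \<le> norm x"
  shows "f x = h x"
proof -
  interpret f: star_hom f by standard fact
  interpret h: star_hom h by standard fact
  have "norm (f x - h x) \<le> 0"
  proof (rule field_le_epsilon)
    fix e :: real assume "0 < e"
    hence "0 < e / 2" by simp
    then obtain y where y: "y \<in> word_polys" "norm (x - y) < e / 2"
      by (rule word_polys_approx)
    have "f y = h y"
      by (rule unital_star_hom_eq_on_word_polys[OF assms(1-3) y(1)])
    hence "f x - h x = f (x - y) - h (x - y)"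
      by (simp add: f.diff h.diff)
    hence "norm (f x - h x) \<le> norm (f (x - y)) + norm (h (x - y))"
      by (metis norm_triangle_ineq4)
    thus "norm (f x - h x) \<le> 0 + e"
      using assms(4)[of "x - y"] assms(5)[of "x - y"] y(2) by linarith
  qed
  thus ?thesis
    by simp
qed

theorem proposition5p1:
  fixes n :: nat and S :: "nat \<Rightarrow> 'a::unital_cstar_algebra"
  assumes "2 \<le> n" and "cuntz_algebra n S"
  shows "\<exists>u \<in> word_sum_unitaries n S.
           (\<exists>\<rho>. is_lambda n S u \<rho>) \<and>
           (\<forall>\<rho>. is_lambda n S u \<rho> \<longrightarrow>
              \<rho> \<notin> {\<psi> \<circ> \<sigma> | \<psi> \<sigma>. \<psi> \<in> star_automorphisms \<and> \<sigma> \<in> lambda_core n S})"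
proof -
  interpret generating_cuntz_family n S
    using assms by (rule cuntz_algebra_generating)
  obtain \<sigma> :: "'a \<Rightarrow> 'a" where \<sigma>: "unital_star_hom \<sigma>" "\<And>i. i \<in> {1..n} \<Longrightarrow> \<sigma> (S i) = sheared_generator i"
      "\<And>x. norm (\<sigma> x) \<le> norm x"
    by (rule universal_hom[OF cuntz_family_sheared]) (rule that)
  define u where "u = hom_unitary (amplify \<sigma>)"
  have hom: "unital_star_hom (amplify \<sigma>)"
    by (rule unital_star_hom_amplify[OF \<sigma>(1)])
  have amplify_S: "amplify \<sigma> (S i) = u * S i" if "i \<in> {1..n}" for i
    using that by (simp add: u_def hom_unitary_mult_S)
  have "u \<in> word_sum_unitaries n S"
    using cstar_unitary_hom_unitary[OF hom] is_word_sum_hom_unitary[of \<sigma>] \<sigma>(2)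
    by (simp add: word_sum_unitaries_def u_def is_word_sum_def)
  moreover have "is_lambda n S u (amplify \<sigma>)"
    using hom amplify_S by (simp add: is_lambda_def)
  moreover have "\<rho> \<notin> {\<psi> \<circ> \<sigma> | \<psi> \<sigma>. \<psi> \<in> star_automorphisms \<and> \<sigma> \<in> lambda_core n S}"
    if \<rho>: "is_lambda n S u \<rho>" for \<rho>
  proof
    assume "\<rho> \<in> {\<psi> \<circ> \<sigma> | \<psi> \<sigma>. \<psi> \<in> star_automorphisms \<and> \<sigma> \<in> lambda_core n S}"
    then obtain \<psi> \<tau> w where \<psi>: "unital_star_hom \<psi>" "bij \<psi>" and \<tau>: "unital_star_hom \<tau>"
      "\<And>i. i \<in> {1..n} \<Longrightarrow> \<tau> (S i) = w * S i" and w: "w \<in> core_UHF n S" and \<rho>_eq: "\<rho> = \<psi> \<circ> \<tau>"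
      by (auto simp: star_automorphisms_def lambda_core_def is_lambda_def)
    interpret \<tau>: star_hom \<tau> by standard fact
    \<comment> \<open>The number \<open>\<i>\<close> is chosen because both it and its square -1
      differ from 1, so that the flip applies to \<gamma> and to \<gamma>\<gamma>.\<close>
    have "cuntz_family n (\<lambda>i. \<i> *\<^sub>C S i)"
    proof
      show "2 \<le> n" by fact
    qed (use isometry sum_ranges in
        \<open>simp_all add: star_scaleC mult_scaleC_left mult_scaleC_right scaleC_scaleC\<close>)
    then obtain \<gamma> :: "'a \<Rightarrow> 'a" where \<gamma>: "unital_star_hom \<gamma>"
      "\<And>i. i \<in> {1..n} \<Longrightarrow> \<gamma> (S i) = \<i> *\<^sub>C S i" "\<And>x. norm (\<gamma> x) \<le> norm x"
      by (rule universal_hom) (rule that)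
    interpret \<gamma>: star_hom \<gamma> by standard fact
    have \<gamma>2: "unital_star_hom (\<lambda>x. \<gamma> (\<gamma> x))"
      by (rule unital_star_hom_compose[OF \<gamma>(1) \<gamma>(1)])
    \<comment> \<open>The fourth power fixes the generators, so the third power is an inverse of
      \<gamma>.\<close>
    have \<gamma>4: "\<gamma> (\<gamma> (\<gamma> (\<gamma> x))) = x" for x
    proof (rule contractive_hom_eqI[where f = "\<lambda>x. \<gamma> (\<gamma> (\<gamma> (\<gamma> x)))" and h = "\<lambda>x. x"])
      show "unital_star_hom (\<lambda>x. \<gamma> (\<gamma> (\<gamma> (\<gamma> x))))"
        using unital_star_hom_compose[OF \<gamma>2 \<gamma>2] .
      show "norm (\<gamma> (\<gamma> (\<gamma> (\<gamma> x)))) \<le> norm x" for x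
        by (meson \<gamma>(3) order.trans)
    qed (auto simp: unital_star_hom_id \<gamma>(2) \<gamma>.scaleC \<gamma>.minus scaleC_scaleC)
    hence "bij \<gamma>"
      by (intro o_bij[of "\<lambda>x. \<gamma> (\<gamma> (\<gamma> x))"]) auto
    \<comment> \<open>On words with \<open>length \<mu> = length \<nu>\<close> the gauge factors
      cancel; the fixed point set is closed since \<gamma> is contractive.\<close>
    have \<gamma>_w: "\<gamma> w = w"
    proof -
      let ?W = "{word_isometry S \<mu> * (word_isometry S \<nu>)\<^sup>\<star> | \<mu> \<nu>.
        \<mu> \<in> words n \<and> \<nu> \<in> words n \<and> length \<mu> = length \<nu>}"
      have word_gauge: "\<gamma> (word_isometry S \<mu>) = \<i> ^ length \<mu> *\<^sub>C word_isometry S \<mu>" if "\<mu> \<in> words n" for \<mu>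
        using that
        by (induction \<mu>) (auto simp: \<gamma>.mult \<gamma>(2) mult_scaleC_left mult_scaleC_right scaleC_scaleC mult.commute)
      have "complex_vector.span ?W \<subseteq> {x. \<gamma> x = x}"
      proof (rule complex_vector.span_minimal)
        show "complex_vector.subspace {x. \<gamma> x = x}"
          by (simp add: complex_vector.subspace_def \<gamma>.add \<gamma>.scaleC)
        have "\<i> ^ k * cnj \<i> ^ k = 1" for k
          by (simp flip: power_mult_distrib)
        thus "?W \<subseteq> {x. \<gamma> x = x}"
          by (auto simp: \<gamma>.mult \<gamma>.star word_gauge star_scaleC mult_scaleC_left mult_scaleC_right scaleC_scaleC
              mult.commute)
      qed
      moreover have "closed {x. \<gamma> x = x}"
      proof -
        have "continuous_on UNIV \<gamma>"
          unfolding continuous_on_iff dist_norm \<gamma>.diff[symmetric] using \<gamma>(3) by (meson order.strict_trans1)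
        thus ?thesis
          by (intro closed_Collect_eq continuous_on_id)
      qed
      ultimately show ?thesis
        using w closure_minimal unfolding core_UHF_def by blast
    qed
    define g where "g x = \<psi> (\<gamma> (inv \<psi> x))" for x
    have g: "unital_star_hom g"
      unfolding g_def
      by (rule unital_star_hom_compose[OF \<psi>(1) unital_star_hom_compose[OF \<gamma>(1) unital_star_hom_inv[OF \<psi>]]])
    have "bij g"
    proof -
      have "g = \<psi> \<circ> \<gamma> \<circ> inv \<psi>"
        by (auto simp: g_def)
      thus ?thesis
        using \<psi>(2) \<open>bij \<gamma>\<close> by (simp add: bij_comp bij_imp_bij_inv)
    qed
    interpret g: star_hom g by standard fact
    have \<rho>_polys: "amplify \<sigma> x = \<psi> (\<tau> x)" if "x \<in> word_polys" for x
    proof -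
      have "amplify \<sigma> x = \<rho> x"
        by (rule unital_star_hom_eq_on_word_polys[OF hom, where g = \<rho>, OF _ _ that])
          (use \<rho> amplify_S in \<open>auto simp: is_lambda_def\<close>)
      thus ?thesis
        by (simp add: \<rho>_eq)
    qed
    have \<gamma>_polys: "\<gamma> x \<in> word_polys" if "x \<in> word_polys" for x
      by (rule word_polys_image[OF \<gamma>(1) _ that])
        (auto simp: \<gamma>(2) intro!: complex_vector.subspace_scale word_polys_subspace word_polys_generator)
    have equivariant: "g (amplify \<sigma> x) = amplify \<sigma> (\<gamma> x)" if x: "x \<in> word_polys" for x
    proof -
      \<comment> \<open>On generators this says \<gamma>(w S_i) = w \<gamma>(S_i), which holds
        because \<gamma> fixes \<open>w\<close>.\<close>
      have "\<gamma> (\<tau> x) = \<tau> (\<gamma> x)"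
      proof (rule unital_star_hom_eq_on_word_polys[where f = "\<lambda>x. \<gamma> (\<tau> x)" and g = "\<lambda>x. \<tau> (\<gamma> x)", OF _ _ _ x])
        show "unital_star_hom (\<lambda>x. \<gamma> (\<tau> x))" "unital_star_hom (\<lambda>x. \<tau> (\<gamma> x))"
          by (rule unital_star_hom_compose[OF \<gamma>(1) \<tau>(1)]) (rule unital_star_hom_compose[OF \<tau>(1) \<gamma>(1)])
      qed (auto simp: \<tau>(2) \<gamma>(2) \<gamma>.mult \<gamma>_w \<tau>.scaleC mult_scaleC_right)
      thus ?thesis
        using \<psi>(2) by (simp add: \<rho>_polys x \<gamma>_polys g_def bij_is_inj)
    qed
    have 1: "g (1 - S n * (S n)\<^sup>\<star>) = S n * (S n)\<^sup>\<star>"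
      by (rule gauge_extension_flips[OF \<sigma>(1,2) \<gamma>(1,2) _ _ g \<open>bij g\<close> equivariant]) auto
    have 2: "g (g (1 - S n * (S n)\<^sup>\<star>)) = S n * (S n)\<^sup>\<star>"
    proof (rule gauge_extension_flips[OF \<sigma>(1,2), where \<gamma> = "\<lambda>x. \<gamma> (\<gamma> x)" and z = "-1" and g = "\<lambda>x. g (g x)"])
      show "unital_star_hom (\<lambda>x. \<gamma> (\<gamma> x))" "unital_star_hom (\<lambda>x. g (g x))"
        by (rule \<gamma>2) (rule unital_star_hom_compose[OF g g])
      show "bij (\<lambda>x. g (g x))"
        using bij_comp[OF \<open>bij g\<close> \<open>bij g\<close>] by (simp add: o_def)
    qed (auto simp: \<gamma>(2) \<gamma>.scaleC scaleC_scaleC equivariant \<gamma>_polys)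
    \<comment> \<open>By \<open>1\<close>, \<open>g\<close> maps 1 - e to e, hence e to 1 - e; by
      \<open>1\<close> and \<open>2\<close> together it maps e to e. Multiplying e = 1 - e by
      \<open>S 1\<close>, which \<open>e\<close> kills, gives \<open>S 1 = 0\<close>.\<close>
    define e where "e = S n * (S n)\<^sup>\<star>"
    have "g e = 1 - e"
      using 1 by (simp add: g.diff e_def algebra_simps)
    moreover have "g e = e"
      using 1 2 by (simp add: e_def)
    ultimately have "e = 1 - e"
      by simp
    hence "e * S 1 = S 1 - e * S 1"
      by (metis left_diff_distrib mult_1_left)
    hence "S 1 = 0"
      by (simp add: e_def mult.assoc)
    thus False
      using generators_nonzero by simp
  qed
  ultimately show ?thesis
    by blast
qed

end
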